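(* For positive integers $m\ge n$, the algebra $\mathcal{T}_{n,m}$ is Koszul.
   Context: Let $\mathbb{K}$ be an algebraically closed field of characteristic zero. A semistandard Young tableau of partition shape $\lambda$ is a filling of the Ferrers diagram of $\lambda$ (English notation) with positive integers, strictly increasing down columns and weakly increasing from left to right along rows. For positive integers $m\ge n$, $\mathrm{SSYT}_m^n$ denotes the set of all semistandard Young tableaux of all partition shapes with at most $n$ rows and with entries in $\{1,\dots,m\}$ (including the empty tableau $\emptyset$). For $T$ of shape $\lambda$ and $T'$ of shape $\mu$, $T\star T'$ is the semistandard Young tableau of shape $\lambda+\mu$ obtained by horizontally concatenating the rows of $T$ and $T'$ and sorting the entries in each row in weakly increasing order. $(\mathrm{SSYT}_m^n,\star,\emptyset)$ is a commutative monoid, and the tableaux algebra $\mathcal{T}_{n,m}$ is its monoid algebra over $\mathbb{K}$. It is a graded algebra where a tableau has degree equal to its number of columns; it is generated in degree one by the one-column tableaux, and Koszulity is understood with respect to this grading. *)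

theory Defs
  imports
    "HOL-Library.Poly_Mapping"
    "HOL-Computational_Algebra.Polynomial"
begin

section \<open>Semistandard Young tableaux\<close>

text \<open>A tableau is the list of its rows, from top to bottom. Listing only nonempty rows makes this
  representation unique; the shape is the list of row lengths.\<close>

definition is_ssyt :: "nat list list \<Rightarrow> bool" where
  "is_ssyt T \<longleftrightarrow>
     (\<forall>r \<in> set T. r \<noteq> [] \<and> sorted r \<and> 0 \<notin> set r) \<and>
     (\<forall>i. Suc i < length T \<longrightarrow>
        length (T ! Suc i) \<le> length (T ! i) \<and>
        (\<forall>j < length (T ! Suc i). T ! i ! j < T ! Suc i ! j))"

typedef tableau = "{T. is_ssyt T}"
  morphisms rows Abs_tableau
  by (rule exI[of _ "[]"]) (simp add: is_ssyt_def)

definition row :: "nat list list \<Rightarrow> nat \<Rightarrow> nat list" where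
  "row T i = (if i < length T then T ! i else [])"

definition star_rows :: "nat list list \<Rightarrow> nat list list \<Rightarrow> nat list list" where
  "star_rows S T = map (\<lambda>i. sort (row S i @ row T i)) [0..<max (length S) (length T)]"

definition SSYT :: "nat \<Rightarrow> nat \<Rightarrow> tableau set" where
  "SSYT n m = {T. length (rows T) \<le> n \<and> (\<forall>r \<in> set (rows T). set r \<subseteq> {1..m})}"

definition columns :: "tableau \<Rightarrow> nat" where
  "columns T = length (row (rows T) 0)"

lemma sorted_nth_le_iff:
  fixes xs :: "nat list"
  assumes "sorted xs"
  shows "j < length (filter (\<lambda>y. y \<le> x) xs) \<longleftrightarrow> j < length xs \<and> xs ! j \<le> x"
  using assms
proof (induction xs arbitrary: j)
  case (Cons a xs)
  show ?case
  proof (cases "a \<le> x")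
    case True
    then show ?thesis using Cons by (cases j) auto
  next
    case False
    then have "\<forall>y \<in> set (a # xs). \<not> y \<le> x" using Cons.prems by auto
    then show ?thesis by (metis filter_False length_0_conv not_less_zero nth_mem)
  qed
qed simp

lemma sorted_nth_less_iff:
  fixes xs :: "nat list"
  assumes "sorted xs"
  shows "j < length (filter (\<lambda>y. y < x) xs) \<longleftrightarrow> j < length xs \<and> xs ! j < x"
proof (cases x)
  case (Suc z)
  have eq: "(\<lambda>y. y < x) = (\<lambda>y. y \<le> z)"
    using Suc by auto
  show ?thesis
    unfolding eq sorted_nth_le_iff[OF assms] using Suc by auto
qed simp

lemma column_strict_iff:
  fixes xs ys :: "nat list"
  assumes "sorted xs" "sorted ys"
  shows "(length ys \<le> length xs \<and> (\<forall>j < length ys. xs ! j < ys ! j)) \<longleftrightarrow>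
    (\<forall>x. length (filter (\<lambda>y. y \<le> x) ys) \<le> length (filter (\<lambda>y. y < x) xs))"
    (is "?L \<longleftrightarrow> ?R")
proof
  assume L: ?L
  show ?R
  proof
    fix x
    have "j < length (filter (\<lambda>y. y < x) xs)" if "j < length (filter (\<lambda>y. y \<le> x) ys)" for j
      using that L unfolding sorted_nth_le_iff[OF assms(2)] sorted_nth_less_iff[OF assms(1)]
      by fastforce
    then show "length (filter (\<lambda>y. y \<le> x) ys) \<le> length (filter (\<lambda>y. y < x) xs)"
      using not_less by blast
  qed
next
  assume R: ?R
  have *: "j < length xs \<and> xs ! j < ys ! j" if "j < length ys" for j
  proof -
    have "j < length (filter (\<lambda>y. y \<le> ys ! j) ys)"
      using that by (simp add: sorted_nth_le_iff[OF assms(2)])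
    then have "j < length (filter (\<lambda>y. y < ys ! j) xs)"
      using R less_le_trans by blast
    then show ?thesis by (simp add: sorted_nth_less_iff[OF assms(1)])
  qed
  then show ?L using not_less by blast
qed

lemma is_ssyt_iff_row:
  "is_ssyt T \<longleftrightarrow> [] \<notin> set T \<and> (\<forall>i. sorted (row T i) \<and> 0 \<notin> set (row T i) \<and>
     (\<forall>x. length (filter (\<lambda>y. y \<le> x) (row T (Suc i))) \<le> length (filter (\<lambda>y. y < x) (row T i))))"
    (is "_ \<longleftrightarrow> ?R")
proof
  assume T: "is_ssyt T"
  have s: "sorted (row T i)" "0 \<notin> set (row T i)" for i
    using T by (auto simp: is_ssyt_def row_def)
  have "length (row T (Suc i)) \<le> length (row T i) \<and>
      (\<forall>j < length (row T (Suc i)). row T i ! j < row T (Suc i) ! j)" for i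
    using T by (auto simp: is_ssyt_def row_def)
  then show ?R
    using s T unfolding column_strict_iff[OF s(1) s(1)] by (auto simp: is_ssyt_def)
next
  assume R: ?R
  then have s: "sorted (row T i)" for i by blast
  have c: "length (row T (Suc i)) \<le> length (row T i) \<and>
      (\<forall>j < length (row T (Suc i)). row T i ! j < row T (Suc i) ! j)" for i
    unfolding column_strict_iff[OF s s] using R by blast
  have r: "row T i = T ! i" if "i < length T" for i using that by (simp add: row_def)
  have "sorted q \<and> 0 \<notin> set q" if "q \<in> set T" for q
    using that R r by (metis in_set_conv_nth)
  moreover have "length (T ! Suc i) \<le> length (T ! i) \<and>
      (\<forall>j < length (T ! Suc i). T ! i ! j < T ! Suc i ! j)" if "Suc i < length T" for i
    using c[of i] r[of i] r[of "Suc i"] that by simp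
  ultimately show "is_ssyt T" using R unfolding is_ssyt_def by blast
qed

lemma row_star_rows: "row (star_rows S T) i = sort (row S i @ row T i)"
  by (auto simp: row_def star_rows_def)

lemma length_filter_sort: "length (filter P (sort xs)) = length (filter P xs)"
  by (metis mset_filter mset_sort size_mset)

lemma is_ssyt_star_rows:
  assumes "is_ssyt S" "is_ssyt T"
  shows "is_ssyt (star_rows S T)"
  unfolding is_ssyt_iff_row row_star_rows
proof (intro conjI allI)
  show "[] \<notin> set (star_rows S T)"
  proof
    assume "[] \<in> set (star_rows S T)"
    then obtain i where "i < max (length S) (length T)" "[] = sort (row S i @ row T i)"
      by (auto simp: star_rows_def)
    then have i: "i < length S \<or> i < length T" "sort (row S i @ row T i) = []" by auto
    then have "row S i = []" "row T i = []"
      by (metis length_0_conv length_sort append_is_Nil_conv)+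
    then show False using i(1) assms by (auto simp: row_def is_ssyt_def split: if_splits)
  qed
  fix i x
  show "sorted (sort (row S i @ row T i))" by simp
  show "0 \<notin> set (sort (row S i @ row T i))"
    using assms by (simp add: is_ssyt_iff_row)
  show "length (filter (\<lambda>y. y \<le> x) (sort (row S (Suc i) @ row T (Suc i))))
      \<le> length (filter (\<lambda>y. y < x) (sort (row S i @ row T i)))"
    using assms by (simp add: is_ssyt_iff_row length_filter_sort add_mono)
qed

text \<open>The monoid is written additively, as library monoid algebras require: \<open>S + T\<close> is the
  product \<open>S \<star> T\<close> and \<open>0\<close> is the empty tableau.\<close>

instantiation tableau :: comm_monoid_add
begin

definition zero_tableau :: tableau where
  "0 = Abs_tableau []"

definition plus_tableau :: "tableau \<Rightarrow> tableau \<Rightarrow> tableau" where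
  "S + T = Abs_tableau (star_rows (rows S) (rows T))"

lemma is_ssyt_rows [simp]: "is_ssyt (rows T)"
  using rows by blast

lemma rows_zero [simp]: "rows 0 = []"
  by (simp add: zero_tableau_def Abs_tableau_inverse is_ssyt_def)

lemma rows_plus: "rows (S + T) = star_rows (rows S) (rows T)"
  by (simp add: plus_tableau_def Abs_tableau_inverse is_ssyt_star_rows)

lemma row_rows_plus: "row (rows (S + T)) i = sort (row (rows S) i @ row (rows T) i)"
  by (simp add: rows_plus row_star_rows)

lemma tableau_eqI:
  assumes "\<And>i. row (rows S) i = row (rows T) i"
  shows "S = T"
proof -
  have len: "i < length (rows U) \<longleftrightarrow> row (rows U) i \<noteq> []" for U i
    using is_ssyt_rows[of U] unfolding is_ssyt_def row_def by auto
  then have "i < length (rows S) \<longleftrightarrow> i < length (rows T)" for i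
    using assms by simp
  then have l: "length (rows S) = length (rows T)"
    by (metis less_irrefl linorder_neqE_nat)
  have "rows S = rows T"
  proof (rule nth_equalityI[OF l])
    show "rows S ! i = rows T ! i" if "i < length (rows S)" for i
      using assms[of i] that l by (simp add: row_def)
  qed
  then show ?thesis by (simp add: rows_inject)
qed

instance
proof
  fix S T U :: tableau
  show "S + T + U = S + (T + U)"
    by (intro tableau_eqI) (simp add: row_rows_plus, intro properties_for_sort, auto)
  show "S + T = T + S"
    by (intro tableau_eqI) (simp add: row_rows_plus, intro properties_for_sort, auto)
  show "0 + T = T"
    using is_ssyt_rows[of T] unfolding is_ssyt_iff_row
    by (intro tableau_eqI) (simp add: row_rows_plus, simp add: row_def sorted_sort_id)
qed

end


section \<open>The tableaux algebra\<close>

text \<open>The library type \<open>tableau \<Rightarrow>\<^sub>0 'k\<close> of finitely supported functions, with convolution as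
  product, is the monoid algebra of all tableaux. The algebra below is the subalgebra spanned by
  the submonoid \<open>SSYT n m\<close>, i.e. the monoid algebra of that submonoid.\<close>

definition tableaux_algebra :: "nat \<Rightarrow> nat \<Rightarrow> (tableau \<Rightarrow>\<^sub>0 'k::field) set" where
  "tableaux_algebra n m = {f. Poly_Mapping.keys f \<subseteq> SSYT n m}"

definition tableaux_degree :: "nat \<Rightarrow> nat \<Rightarrow> nat \<Rightarrow> (tableau \<Rightarrow>\<^sub>0 'k::field) set" where
  "tableaux_degree n m i = {f. Poly_Mapping.keys f \<subseteq> {T \<in> SSYT n m. columns T = i}}"

definition tableaux_scale :: "'k \<Rightarrow> (tableau \<Rightarrow>\<^sub>0 'k::field) \<Rightarrow> (tableau \<Rightarrow>\<^sub>0 'k)" where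
  "tableaux_scale c f = Poly_Mapping.map ((*) c) f"


section \<open>Koszul algebras\<close>

text \<open>\<open>A\<close> is a subalgebra of an ambient ring and \<open>G i\<close> is its component of degree \<open>i\<close>.\<close>

locale connected_graded_algebra = vector_space scale
  for scale :: "'k::field \<Rightarrow> 'a::ring_1 \<Rightarrow> 'a" +
  fixes A :: "'a set" and G :: "nat \<Rightarrow> 'a set"
  assumes scale_mult_left: "scale c (x * y) = scale c x * y"
    and scale_mult_right: "scale c (x * y) = x * scale c y"
    and subspace_degree: "subspace (G i)"
    and span_degrees: "A = span (\<Union>i. G i)"
    and degrees_independent: "(\<And>i. i \<le> N \<Longrightarrow> g i \<in> G i) \<Longrightarrow> (\<Sum>i\<le>N. g i) = 0 \<Longrightarrow> i \<le> N \<Longrightarrow> g i = 0"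
    and degree_mult: "a \<in> G i \<Longrightarrow> b \<in> G j \<Longrightarrow> a * b \<in> G (i + j)"
    and connected: "G 0 = range (\<lambda>c. scale c 1)"
begin

text \<open>The augmentation is the projection \<open>A \<rightarrow> A\<^sub>0 = K\<close> along the ideal of elements of positive degree. The trivial
  module is \<open>K\<close>, on which \<open>a \<in> A\<close> acts as multiplication by \<open>augmentation a\<close>.\<close>

definition augmentation :: "'a \<Rightarrow> 'k" where
  "augmentation a = (THE c. a - scale c 1 \<in> span (\<Union>i\<in>{0<..}. G i))"

text \<open>\<open>free_module S r\<close> consists of the vectors of length \<open>r\<close> with entries in \<open>S\<close>, padded by zeros,
  and \<open>free_module_degree r s j\<close> is the component of degree \<open>j\<close> of the free module \<open>A(-s)\<^sup>r\<close>, whose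
  \<open>r\<close> basis vectors sit in degree \<open>s\<close>.\<close>

definition free_module :: "'a set \<Rightarrow> nat \<Rightarrow> (nat \<Rightarrow> 'a) set" where
  "free_module S r = {v. (\<forall>k<r. v k \<in> S) \<and> (\<forall>k\<ge>r. v k = 0)}"

definition free_module_degree :: "nat \<Rightarrow> nat \<Rightarrow> nat \<Rightarrow> (nat \<Rightarrow> 'a) set" where
  "free_module_degree r s j = (if s \<le> j then free_module (G (j - s)) r else {\<lambda>_. 0})"

text \<open>An exact sequence of graded left \<open>A\<close>-modules and homomorphisms of degree \<open>0\<close>
  \[ \cdots \to A(-2)^{r_2} \to A(-1)^{r_1} \to A^{r_0} \to K \to 0, \]
  where \<open>d i\<close> has source \<open>A(-(i+1))^{r (i+1)}\<close> and target \<open>A(-i)^{r i}\<close>, and \<open>K\<close> sits in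
  degree \<open>0\<close>. Finite ranks are no restriction for locally finite-dimensional \<open>A\<close>: a linear
  resolution is minimal, so its \<open>i\<close>-th rank is at most \<open>dim A\<^sub>1\<close> to the power \<open>i\<close>.\<close>

definition linear_resolution ::
    "(nat \<Rightarrow> nat) \<Rightarrow> (nat \<Rightarrow> (nat \<Rightarrow> 'a) \<Rightarrow> (nat \<Rightarrow> 'a)) \<Rightarrow> ((nat \<Rightarrow> 'a) \<Rightarrow> 'k) \<Rightarrow> bool" where
  "linear_resolution r d \<eta> \<longleftrightarrow>
     (\<forall>u \<in> free_module A (r 0). \<forall>v \<in> free_module A (r 0). \<eta> (\<lambda>k. u k + v k) = \<eta> u + \<eta> v) \<and>
     (\<forall>a \<in> A. \<forall>v \<in> free_module A (r 0). \<eta> (\<lambda>k. a * v k) = augmentation a * \<eta> v) \<and>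
     (\<forall>j>0. \<forall>v \<in> free_module_degree (r 0) 0 j. \<eta> v = 0) \<and>
     \<eta> ` free_module A (r 0) = UNIV \<and>
     (\<forall>i. \<forall>u \<in> free_module A (r (Suc i)). \<forall>v \<in> free_module A (r (Suc i)).
        d i (\<lambda>k. u k + v k) = (\<lambda>k. d i u k + d i v k)) \<and>
     (\<forall>i. \<forall>a \<in> A. \<forall>v \<in> free_module A (r (Suc i)). d i (\<lambda>k. a * v k) = (\<lambda>k. a * d i v k)) \<and>
     (\<forall>i j. d i ` free_module_degree (r (Suc i)) (Suc i) j \<subseteq> free_module_degree (r i) i j) \<and>
     d 0 ` free_module A (r 1) = {v \<in> free_module A (r 0). \<eta> v = 0} \<and>
     (\<forall>i. d (Suc i) ` free_module A (r (Suc (Suc i))) =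
        {v \<in> free_module A (r (Suc i)). d i v = (\<lambda>_. 0)})"

end

locale koszul_algebra = connected_graded_algebra +
  assumes has_linear_resolution: "\<exists>r d \<eta>. linear_resolution r d \<eta>"

end

theory Submission
  imports Defs "HOL-Library.Extended_Nat"
begin

text \<open>
  Order the one-column tableaux entrywise, reading a missing entry as \<open>\<infinity>\<close>. They form a distributive
  lattice, and the product of two columns \<open>c\<close> and \<open>d\<close> is \<open>(c \<and> d) \<star> (c \<or> d)\<close>, because sorting a row
  with two entries puts their minimum first. So the tableaux algebra is a Hibi ring, and such rings
  are Koszul for the following reason.

  Let \<open>D\<close> be a down-set of columns. The first column of \<open>S \<star> T\<close> is the meet of the first columns of \<open>S\<close>
  and \<open>T\<close>, where that of the empty tableau counts as the top element. So the ideal generated by \<open>D\<close> is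
  spanned by the tableaux whose first column lies in \<open>D\<close> (\<open>left_ideal_initial_list\<close>). Let now \<open>d\<close> be minimal outside \<open>D\<close>. The first column of \<open>T \<star> d\<close> is
  \<open>d \<notin> D\<close> if \<open>d\<close> lies below the first column of \<open>T\<close>, and otherwise it lies strictly below \<open>d\<close>, hence in
  \<open>D\<close> (\<open>first_column_plus_mem_iff\<close>). Therefore the colon ideal \<open>(D) : d\<close> is generated by the columns \<open>c\<close>
  with \<open>d \<not>\<le> c\<close>, which again form a down-set. If the columns of a down-set are adjoined one by one along
  a linear extension of the order, every colon ideal on the way thus belongs to the same family of
  ideals. That is, the ideals of down-sets form a Koszul filtration
  (\<open>koszul_filtration_initial_lists\<close>); the ideal of all columns is the irrelevant ideal.

  A Koszul filtration gives a linear resolution of \<open>K\<close> (\<open>koszul_filtration_imp_koszul\<close>). Say that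
  vectors \<open>g\<^sub>0, g\<^sub>1, \<dots>\<close> with linear entries have linear quotients if each colon ideal
  \<open>(g\<^sub>0, \<dots>, g\<^bsub>j-1\<^esub>) : g\<^sub>j\<close> belongs to the filtration. Every generator \<open>y\<close> of that colon ideal lifts to a
  syzygy with linear entries that has \<open>y\<close> in position \<open>j\<close> and vanishes in all later positions. Together
  these syzygies generate the syzygy module, and they again have linear quotients, because their
  colon ideals are those of the generators \<open>y\<close> in the filtration
  (\<open>linear_quotients_syzygies\<close>). Iterating from the irrelevant ideal produces the resolution.
\<close>


section \<open>Graded algebras and their augmentation\<close>

context connected_graded_algebra
begin

lemma mult_mem_span:
  assumes "\<And>x y. x \<in> X \<Longrightarrow> y \<in> Y \<Longrightarrow> x * y \<in> span Z" "a \<in> span X" "b \<in> span Y"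
  shows "a * b \<in> span Z"
proof -
  have *: "x * b \<in> span Z" if x: "x \<in> X" for x
    using assms(3)
  proof (rule span_induct)
    show "subspace {b. x * b \<in> span Z}"
      by (rule subspaceI)
        (auto simp: span_zero distrib_left span_add span_scale simp flip: scale_mult_right)
  qed (use assms(1) x in auto)
  show ?thesis
    using assms(2)
  proof (rule span_induct)
    show "subspace {a. a * b \<in> span Z}"
      by (rule subspaceI)
        (auto simp: span_zero distrib_right span_add span_scale simp flip: scale_mult_left)
  qed (use * in auto)
qed

lemma degree_subset: "G i \<subseteq> A"
  unfolding span_degrees using span_superset by blast

lemma subspace_A: "subspace A"
  unfolding span_degrees by (rule subspace_span)

lemma mult_mem_A: "a \<in> A \<Longrightarrow> b \<in> A \<Longrightarrow> a * b \<in> A"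
  unfolding span_degrees
  by (rule mult_mem_span[where X = "\<Union>i. G i" and Y = "\<Union>i. G i"])
    (auto intro!: span_base dest: degree_mult)

lemma one_mem: "1 \<in> G 0"
  unfolding connected using rangeI[of "\<lambda>c. scale c 1" 1] by simp

lemma homogeneous_decomposition:
  assumes "a \<in> span (\<Union>i\<in>I. G i)"
  shows "\<exists>f N. (\<forall>i. f i \<in> G i) \<and> (\<forall>i. i \<notin> I \<longrightarrow> f i = 0) \<and> (\<forall>M\<ge>N. a = (\<Sum>i\<le>M. f i))"
proof -
  define P where "P a f N \<longleftrightarrow>
      (\<forall>i. f i \<in> G i) \<and> (\<forall>i. i \<notin> I \<longrightarrow> f i = 0) \<and> (\<forall>M\<ge>N. a = (\<Sum>i\<le>M. f i))" for a f N
  have "\<exists>f N. P a f N"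
    using assms
  proof (rule span_induct)
    show "subspace {a. \<exists>f N. P a f N}"
    proof (rule subspaceI; clarify)
      have "P 0 (\<lambda>_. 0) 0"
        using subspace_0[OF subspace_degree] by (simp add: P_def)
      then show "\<exists>f N. P 0 f N" by blast
    next
      fix x y f N g K
      assume "P x f N" "P y g K"
      then have "P (x + y) (\<lambda>i. f i + g i) (max N K)"
        using subspace_add[OF subspace_degree] by (simp add: P_def sum.distrib) metis
      then show "\<exists>f N. P (x + y) f N" by blast
    next
      fix c x f N
      assume "P x f N"
      then have "P (scale c x) (\<lambda>i. scale c (f i)) N"
        using subspace_scale[OF subspace_degree] by (simp add: P_def scale_sum_right)
      then show "\<exists>f N. P (scale c x) f N" by blast
    qed
    fix a assume "a \<in> (\<Union>i\<in>I. G i)"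
    then obtain l where l: "l \<in> I" "a \<in> G l" by blast
    then have "P a (\<lambda>i. if i = l then a else 0) l"
      using subspace_0[OF subspace_degree] by (auto simp: P_def sum.delta)
    then show "\<exists>f N. P a f N" by blast
  qed
  then show ?thesis unfolding P_def .
qed

lemma homogeneous_parts_unique:
  assumes "\<And>i. f i \<in> G i" "\<And>i. g i \<in> G i" "(\<Sum>i\<le>N. f i) = (\<Sum>i\<le>N. g i)" "i \<le> N"
  shows "f i = g i"
proof -
  have "(\<Sum>i\<le>N. f i - g i) = 0"
    using assms(3) by (simp add: sum_subtractf)
  then have "f i - g i = 0"
    using degrees_independent[of N "\<lambda>i. f i - g i" i] assms subspace_diff[OF subspace_degree]
    by blast
  then show ?thesis by simp
qed

definition irrelevant_ideal :: "'a set" where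
  "irrelevant_ideal = span (\<Union>i\<in>{0<..}. G i)"

lemma subspace_irrelevant: "subspace irrelevant_ideal"
  unfolding irrelevant_ideal_def by (rule subspace_span)

lemma irrelevant_subset: "irrelevant_ideal \<subseteq> A"
  unfolding irrelevant_ideal_def span_degrees by (rule span_mono) blast

lemma scalar_mem_irrelevant_iff: "scale c 1 \<in> irrelevant_ideal \<longleftrightarrow> c = 0"
proof
  assume "scale c 1 \<in> irrelevant_ideal"
  from homogeneous_decomposition[OF this[unfolded irrelevant_ideal_def]]
  obtain f N where f: "\<And>i. f i \<in> G i" "f 0 = 0" "scale c 1 = (\<Sum>i\<le>N. f i)" by auto
  define g where "g = (\<lambda>i::nat. if i = 0 then scale c 1 else 0)"
  have g: "g i \<in> G i" for i
    using subspace_0[OF subspace_degree] connected by (auto simp: g_def)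
  have "(\<Sum>i\<le>N. f i) = (\<Sum>i\<le>N. g i)"
    by (simp add: g_def f(3)[symmetric] sum.delta)
  from homogeneous_parts_unique[OF f(1) g this, of 0] show "c = 0"
    using f(2) by (simp add: g_def)
qed (simp add: subspace_0 subspace_irrelevant)

lemma augmentation_eqI:
  assumes "a - scale c 1 \<in> irrelevant_ideal"
  shows "augmentation a = c"
  unfolding augmentation_def irrelevant_ideal_def[symmetric]
proof (rule the_equality)
  fix c' assume "a - scale c' 1 \<in> irrelevant_ideal"
  with assms have "(a - scale c 1) - (a - scale c' 1) \<in> irrelevant_ideal"
    using subspace_diff[OF subspace_irrelevant] by blast
  then have "scale (c' - c) 1 \<in> irrelevant_ideal"
    by (simp add: scale_left_diff_distrib)
  then show "c' = c" by (simp add: scalar_mem_irrelevant_iff)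
qed (rule assms)

lemma augmentation_mem:
  assumes "a \<in> A"
  shows "a - scale (augmentation a) 1 \<in> irrelevant_ideal"
proof -
  obtain f N where f: "\<And>i. f i \<in> G i" "a = (\<Sum>i\<le>N. f i)"
    using homogeneous_decomposition[of a UNIV] assms span_degrees by auto
  obtain c where c: "f 0 = scale c 1" using f(1)[of 0] connected by blast
  have "a - scale c 1 = (\<Sum>i\<in>{..N} - {0}. f i)"
    using c by (simp add: f(2) sum_diff1)
  also have "\<dots> \<in> irrelevant_ideal"
    unfolding irrelevant_ideal_def using f(1) by (intro span_sum) (auto intro: span_base)
  finally show ?thesis using augmentation_eqI by metis
qed

lemma augmentation_eq_0_iff: "a \<in> A \<Longrightarrow> augmentation a = 0 \<longleftrightarrow> a \<in> irrelevant_ideal"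
  using augmentation_mem[of a] augmentation_eqI[of a 0] by auto

lemma augmentation_add:
  assumes "a \<in> A" "b \<in> A"
  shows "augmentation (a + b) = augmentation a + augmentation b"
proof (rule augmentation_eqI)
  have "(a - scale (augmentation a) 1) + (b - scale (augmentation b) 1) \<in> irrelevant_ideal"
    by (intro subspace_add subspace_irrelevant augmentation_mem assms)
  then show "a + b - scale (augmentation a + augmentation b) 1 \<in> irrelevant_ideal"
    by (simp add: scale_left_distrib algebra_simps)
qed

lemma mult_irrelevant: "a \<in> A \<Longrightarrow> b \<in> irrelevant_ideal \<Longrightarrow> a * b \<in> irrelevant_ideal"
  unfolding irrelevant_ideal_def span_degrees
  by (rule mult_mem_span[where X = "\<Union>i. G i"])
    (auto intro!: span_base dest: degree_mult)

lemma augmentation_mult: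
  assumes "a \<in> A" "b \<in> A"
  shows "augmentation (a * b) = augmentation a * augmentation b"
proof (rule augmentation_eqI)
  let ?a = "augmentation a" and ?b = "augmentation b"
  have "a * (b - scale ?b 1) + scale ?b (a - scale ?a 1) \<in> irrelevant_ideal"
    by (intro subspace_add subspace_irrelevant mult_irrelevant subspace_scale augmentation_mem assms)
  also have "a * (b - scale ?b 1) + scale ?b (a - scale ?a 1) = a * b - scale (?a * ?b) 1"
    using scale_mult_right[of ?b a 1]
    by (simp add: right_diff_distrib scale_right_diff_distrib mult.commute)
  finally show "a * b - scale (?a * ?b) 1 \<in> irrelevant_ideal" .
qed


section \<open>Koszul filtrations\<close>

definition left_ideal :: "'a list \<Rightarrow> 'a set" where
  "left_ideal xs = {\<Sum>i<length xs. b i * xs ! i |b. \<forall>i. b i \<in> A}"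

text \<open>With \<open>b\<close> as argument this is the \<open>A\<close>-linear map from a free module that sends the basis vectors
  to \<open>gs\<close>; all differentials below have this form.\<close>

definition combination :: "(nat \<Rightarrow> 'a) list \<Rightarrow> (nat \<Rightarrow> 'a) \<Rightarrow> nat \<Rightarrow> 'a" where
  "combination gs b = (\<lambda>k. \<Sum>i<length gs. b i * (gs ! i) k)"

definition left_span :: "(nat \<Rightarrow> 'a) list \<Rightarrow> (nat \<Rightarrow> 'a) set" where
  "left_span gs = {combination gs b |b. \<forall>i. b i \<in> A}"

text \<open>A family of left ideals is given by generating lists of linear forms, because the colon condition
  depends on the order in which the generators are adjoined.\<close>

definition koszul_filtration :: "'a list set \<Rightarrow> bool" where
  "koszul_filtration F \<longleftrightarrow>
     (\<forall>xs\<in>F. set xs \<subseteq> G 1 \<and>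
        (\<forall>j<length xs. \<exists>ys\<in>F. {a \<in> A. a * xs ! j \<in> left_ideal (take j xs)} = left_ideal ys)) \<and>
     (\<exists>xs\<in>F. left_ideal xs = irrelevant_ideal)"

definition linear_quotients :: "'a list set \<Rightarrow> (nat \<Rightarrow> 'a) list \<Rightarrow> bool" where
  "linear_quotients F gs \<longleftrightarrow> (\<forall>j<length gs. \<exists>ys\<in>F.
     {a \<in> A. (\<lambda>k. a * (gs ! j) k) \<in> left_span (take j gs)} = left_ideal ys)"

lemma zero_mem_A: "0 \<in> A"
  using subspace_A by (rule subspace_0)

lemma combination_free_module:
  assumes "set gs \<subseteq> free_module (G s) r" "\<And>i. i < length gs \<Longrightarrow> b i \<in> G t"
  shows "combination gs b \<in> free_module (G (t + s)) r"
proof -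
  have "gs ! i \<in> free_module (G s) r" if "i < length gs" for i
    using assms(1) that nth_mem by blast
  then show ?thesis
    unfolding free_module_def combination_def using assms(2)
    by (auto intro!: subspace_sum[OF subspace_degree] degree_mult sum.neutral)
qed

lemma left_span_eq_image: "left_span gs = combination gs ` free_module A (length gs)"
proof
  show "left_span gs \<subseteq> combination gs ` free_module A (length gs)"
  proof
    fix v assume "v \<in> left_span gs"
    then obtain b where b: "\<forall>i. b i \<in> A" "v = combination gs b" by (auto simp: left_span_def)
    have "v = combination gs (\<lambda>i. if i < length gs then b i else 0)"
      by (simp add: b(2) combination_def)
    moreover have "(\<lambda>i. if i < length gs then b i else 0) \<in> free_module A (length gs)"
      using b(1) by (simp add: free_module_def)
    ultimately show "v \<in> combination gs ` free_module A (length gs)" by blast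
  qed
  have "\<forall>i. v i \<in> A" if "v \<in> free_module A (length gs)" for v
    using that zero_mem_A by (auto simp: free_module_def) (metis not_less)
  then show "combination gs ` free_module A (length gs) \<subseteq> left_span gs"
    by (auto simp: left_span_def)
qed

lemma combination_append:
  "combination (gs @ hs) b = (\<lambda>k. combination gs b k + combination hs (\<lambda>i. b (length gs + i)) k)"
proof -
  have "(\<Sum>i<length gs + n. f i) = (\<Sum>i<length gs. f i) + (\<Sum>i<n. f (length gs + i))"
    for f :: "nat \<Rightarrow> 'a" and n
    by (induction n) (simp_all add: add.assoc)
  then show ?thesis by (simp add: combination_def nth_append)
qed

lemma left_span_append:
  "v \<in> left_span (gs @ hs) \<longleftrightarrow>
    (\<exists>c. (\<forall>i. c i \<in> A) \<and> (\<lambda>k. v k - combination hs c k) \<in> left_span gs)"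
proof
  assume "v \<in> left_span (gs @ hs)"
  then obtain b where b: "\<forall>i. b i \<in> A" "v = combination (gs @ hs) b"
    unfolding left_span_def by blast
  have "(\<lambda>k. v k - combination hs (\<lambda>i. b (length gs + i)) k) = combination gs b"
    by (simp add: b(2) combination_append)
  then show "\<exists>c. (\<forall>i. c i \<in> A) \<and> (\<lambda>k. v k - combination hs c k) \<in> left_span gs"
    using b(1) unfolding left_span_def
    by (intro exI[of _ "\<lambda>i. b (length gs + i)"]) auto
next
  assume "\<exists>c. (\<forall>i. c i \<in> A) \<and> (\<lambda>k. v k - combination hs c k) \<in> left_span gs"
  then obtain b c where bc: "\<forall>i. b i \<in> A" "\<forall>i. c i \<in> A"
    "(\<lambda>k. v k - combination hs c k) = combination gs b"
    unfolding left_span_def by auto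
  define e where "e i = (if i < length gs then b i else c (i - length gs))" for i
  have "combination (gs @ hs) e = (\<lambda>k. combination gs b k + combination hs c k)"
    unfolding combination_append by (simp add: e_def combination_def)
  also have "\<dots> = v"
    unfolding bc(3)[symmetric] by simp
  finally have "v = combination (gs @ hs) e" ..
  moreover have "\<forall>i. e i \<in> A" using bc(1,2) by (simp add: e_def)
  ultimately show "v \<in> left_span (gs @ hs)" unfolding left_span_def by blast
qed

text \<open>All entries of \<open>y g\<close> have degree two and those of \<open>gs\<close> have degree one. So the components of
  degree one of arbitrary coefficients already satisfy the relation. This is what makes the lifted
  syzygies, and hence the resolution, linear.\<close>

lemma linear_coefficients:
  assumes gs: "set gs \<subseteq> free_module (G 1) r" and g: "g \<in> free_module (G 1) r"
    and y: "y \<in> G 1" and rel: "(\<lambda>k. y * g k) \<in> left_span gs"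
  shows "\<exists>b. (\<forall>i<length gs. b i \<in> G 1) \<and> (\<lambda>k. y * g k) = combination gs b"
proof -
  obtain b where b: "\<And>i. b i \<in> A" "(\<lambda>k. y * g k) = combination gs b"
    using rel unfolding left_span_def by blast
  have "\<forall>i. \<exists>f N. (\<forall>l. f l \<in> G l) \<and> (\<forall>M\<ge>N. b i = (\<Sum>l\<le>M. f l))"
    using homogeneous_decomposition[of _ UNIV] b(1) span_degrees by auto
  then obtain f N where f: "\<And>i l. f i l \<in> G l" "\<And>i M. M \<ge> N i \<Longrightarrow> b i = (\<Sum>l\<le>M. f i l)"
    by metis
  \<comment> \<open>A common bound for the degrees of all coefficients, large enough to include degree two.\<close>
  define M where "M = (\<Sum>i<length gs. N i) + 2"
  have M: "N i \<le> M" if "i < length gs" for i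
    using member_le_sum[of i "{..<length gs}" N] that by (simp add: M_def)
  have "(\<lambda>k. y * g k) = combination gs (\<lambda>i. f i 1)"
  proof
    fix k
    \<comment> \<open>The homogeneous components of the two sides of the relation, in coordinate \<open>k\<close>.\<close>
    define u where "u l = (case l of 0 \<Rightarrow> 0 | Suc l \<Rightarrow> combination gs (\<lambda>i. f i l) k)" for l
    define w where "w l = (if l = 2 then y * g k else 0)" for l :: nat
    have mem: "h k \<in> G s" if "h \<in> free_module (G s) r" for h s
      using that subspace_0[OF subspace_degree] unfolding free_module_def by (cases "k < r") auto
    have u: "u l \<in> G l" for l
    proof (cases l)
      case 0
      then show ?thesis using subspace_0[OF subspace_degree] by (simp add: u_def)
    next
      case (Suc l')
      have "combination gs (\<lambda>i. f i l') \<in> free_module (G (l' + 1)) r"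
        by (rule combination_free_module[OF gs]) (rule f)
      from mem[OF this] show ?thesis by (simp add: u_def Suc)
    qed
    have w: "w l \<in> G l" for l
      using degree_mult[OF y mem[OF g]] subspace_0[OF subspace_degree]
      by (simp add: w_def numeral_2_eq_2)
    have "2 \<le> Suc M" by (simp add: M_def)
    then have "(\<Sum>l\<le>Suc M. w l) = y * g k"
      unfolding w_def by (subst sum.delta) auto
    also have "\<dots> = (\<Sum>i<length gs. b i * (gs ! i) k)"
      using fun_cong[OF b(2), of k] by (simp add: combination_def)
    also have "\<dots> = (\<Sum>i<length gs. \<Sum>l\<le>M. f i l * (gs ! i) k)"
      by (intro sum.cong refl) (simp add: f(2)[OF M] sum_distrib_right)
    also have "\<dots> = (\<Sum>l\<le>M. \<Sum>i<length gs. f i l * (gs ! i) k)"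
      by (rule sum.swap)
    also have "\<dots> = (\<Sum>l\<le>Suc M. u l)"
      by (simp only: sum.atMost_Suc_shift) (simp add: u_def combination_def)
    finally have "u 2 = w 2"
      by (intro homogeneous_parts_unique[OF u w, of "Suc M"]) (simp_all add: M_def)
    then show "y * g k = combination gs (\<lambda>i. f i 1) k"
      by (simp add: u_def w_def numeral_2_eq_2)
  qed
  moreover have "\<forall>i<length gs. f i 1 \<in> G 1" using f(1) by blast
  ultimately show ?thesis by (intro exI[of _ "\<lambda>i. f i 1"] conjI)
qed

definition syzygies :: "(nat \<Rightarrow> 'a) list \<Rightarrow> (nat \<Rightarrow> 'a) set" where
  "syzygies gs = {v \<in> free_module A (length gs). combination gs v = (\<lambda>_. 0)}"

lemma syzygies_linear_combination:
  assumes "v \<in> syzygies gs" "set hs \<subseteq> syzygies gs" "\<forall>i. c i \<in> A"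
  shows "(\<lambda>k. v k - combination hs c k) \<in> syzygies gs"
    and "(\<lambda>k. v k + combination hs c k) \<in> syzygies gs"
proof -
  have h: "hs ! i \<in> syzygies gs" if "i < length hs" for i
    using assms(2) that by (meson nth_mem subsetD)
  have hA: "(hs ! i) k \<in> A" if "i < length hs" "k < length gs" for i k
    using h[OF that(1)] that(2) by (simp add: syzygies_def free_module_def)
  have h0: "(hs ! i) k = 0" if "i < length hs" "k \<ge> length gs" for i k
    using h[OF that(1)] that(2) by (simp add: syzygies_def free_module_def)
  have hc: "(\<Sum>l<length gs. (hs ! i) l * (gs ! l) k) = 0" if "i < length hs" for i k
    using fun_cong[of _ _ k, OF conjunct2[OF h[OF that, unfolded syzygies_def mem_Collect_eq]]]
    by (simp add: combination_def)
  have free: "combination hs c \<in> free_module A (length gs)"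
    unfolding free_module_def combination_def using assms(3) hA h0
    by (auto intro!: subspace_sum[OF subspace_A] mult_mem_A sum.neutral)
  have "combination gs (combination hs c) = (\<lambda>_. 0)"
  proof
    fix k
    have "combination gs (combination hs c) k =
        (\<Sum>l<length gs. \<Sum>i<length hs. c i * ((hs ! i) l * (gs ! l) k))"
      by (simp add: combination_def sum_distrib_right mult.assoc)
    also have "\<dots> = (\<Sum>i<length hs. c i * (\<Sum>l<length gs. (hs ! i) l * (gs ! l) k))"
      by (subst sum.swap) (simp add: sum_distrib_left)
    also have "\<dots> = 0" by (simp add: hc)
    finally show "combination gs (combination hs c) k = 0" .
  qed
  then have z: "(\<Sum>l<length gs. combination hs c l * (gs ! l) k) = 0" for k
    by (simp add: combination_def fun_eq_iff)
  have v: "v \<in> free_module A (length gs)" "(\<Sum>l<length gs. v l * (gs ! l) k) = 0" for k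
    using assms(1) by (auto simp: syzygies_def combination_def fun_eq_iff)
  show "(\<lambda>k. v k - combination hs c k) \<in> syzygies gs"
    using v z free subspace_diff[OF subspace_A]
    by (simp add: syzygies_def free_module_def combination_def[of gs] left_diff_distrib
        sum_subtractf)
  show "(\<lambda>k. v k + combination hs c k) \<in> syzygies gs"
    using v z free subspace_add[OF subspace_A]
    by (simp add: syzygies_def free_module_def combination_def[of gs] distrib_right
        sum.distrib)
qed

lemma syzygies_snoc:
  assumes "v (length gs) = 0"
  shows "v \<in> syzygies (gs @ [g]) \<longleftrightarrow> v \<in> syzygies gs"
proof -
  have "v \<in> free_module A (length (gs @ [g])) \<longleftrightarrow> v \<in> free_module A (length gs)"
    using assms zero_mem_A unfolding free_module_def
    by (auto simp: less_Suc_eq) (metis le_antisym not_less_eq_eq)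
  moreover have "combination (gs @ [g]) v = combination gs v"
    using assms by (simp add: combination_def nth_append)
  ultimately show ?thesis by (simp add: syzygies_def)
qed

text \<open>The induction adjoins one generator \<open>g\<close> at a time. A syzygy of \<open>gs @ [g]\<close> has its last entry in the
  colon ideal \<open>(gs) : g\<close>, and two syzygies with the same last entry differ by a syzygy of \<open>gs\<close>. So the
  syzygies of \<open>gs\<close> together with one linear lift of each generator of the colon ideal generate
  everything, and modulo the syzygies of \<open>gs\<close> the lifts behave like the generators that they lift.\<close>

lemma linear_quotients_syzygies:
  assumes F: "koszul_filtration F"
    and gs: "set gs \<subseteq> free_module (G 1) r" "linear_quotients F gs"
  shows "\<exists>hs. set hs \<subseteq> free_module (G 1) (length gs) \<and> linear_quotients F hs \<and>
    left_span hs = syzygies gs"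
  using gs
proof (induction gs rule: rev_induct)
  case Nil
  have "free_module A 0 = {\<lambda>_. 0}"
    by (auto simp: free_module_def)
  then have "left_span [] = syzygies []"
    by (auto simp: left_span_eq_image syzygies_def combination_def)
  then show ?case
    by (intro exI[of _ "[]"]) (simp add: linear_quotients_def)
next
  case (snoc g gs)
  have g: "g \<in> free_module (G 1) r" and gs: "set gs \<subseteq> free_module (G 1) r"
    using snoc.prems(1) by auto
  let ?n = "length gs"
  let ?S = "syzygies (gs @ [g])"
  have "linear_quotients F gs"
    unfolding linear_quotients_def
  proof (intro allI impI)
    fix j assume "j < ?n"
    then show "\<exists>ys\<in>F. {a \<in> A. (\<lambda>k. a * (gs ! j) k) \<in> left_span (take j gs)} = left_ideal ys"
      using snoc.prems(2)[unfolded linear_quotients_def, rule_format, of j]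
      by (simp add: nth_append)
  qed
  from snoc.IH[OF gs this] obtain hs where hs: "set hs \<subseteq> free_module (G 1) ?n"
    "linear_quotients F hs" "left_span hs = syzygies gs" by blast
  obtain ys where ys: "ys \<in> F" "{a \<in> A. (\<lambda>k. a * g k) \<in> left_span gs} = left_ideal ys"
    using snoc.prems(2)[unfolded linear_quotients_def, rule_format, of ?n] by auto
  have ysF: "set ys \<subseteq> G 1" and ysq: "\<And>l. l < length ys \<Longrightarrow>
      \<exists>zs\<in>F. {a \<in> A. a * ys ! l \<in> left_ideal (take l ys)} = left_ideal zs"
    using F ys(1) unfolding koszul_filtration_def by blast+
  \<comment> \<open>Each generator of the colon ideal is the last entry of a linear syzygy.\<close>
  have "\<exists>h. h \<in> free_module (G 1) (Suc ?n) \<and> h \<in> ?S \<and> h ?n = y" if y: "y \<in> set ys" for y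
  proof -
    have y1: "y \<in> G 1" using y ysF by blast
    obtain i where i: "i < length ys" "ys ! i = y" using y by (metis in_set_conv_nth)
    have "y = (\<Sum>l<length ys. (if l = i then 1 else 0) * ys ! l)"
      using i by (simp add: if_distrib[of "\<lambda>x. x * _"] sum.delta cong: if_cong)
    then have "y \<in> left_ideal ys"
      unfolding left_ideal_def using one_mem degree_subset zero_mem_A
      by (intro CollectI exI[of _ "\<lambda>l. if l = i then 1 else 0"]) auto
    then have "(\<lambda>k. y * g k) \<in> left_span gs" using ys(2) by blast
    from linear_coefficients[OF gs g y1 this]
    obtain b where b: "\<forall>i<?n. b i \<in> G 1" "(\<lambda>k. y * g k) = combination gs b"
      by (elim exE conjE)
    define h where "h i = (if i < ?n then - b i else if i = ?n then y else 0)" for i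
    have h1: "h \<in> free_module (G 1) (Suc ?n)"
      using b(1) y1 subspace_neg[OF subspace_degree]
      by (auto simp: free_module_def h_def less_Suc_eq)
    have "combination (gs @ [g]) h = (\<lambda>_. 0)"
      using b(2) by (simp add: combination_def h_def nth_append sum_negf fun_eq_iff)
    then have "h \<in> ?S"
      using h1 degree_subset by (auto simp: syzygies_def free_module_def)
    then show ?thesis using h1 by (auto simp: h_def)
  qed
  then obtain h where h: "\<And>y. y \<in> set ys \<Longrightarrow> h y \<in> free_module (G 1) (Suc ?n)"
    "\<And>y. y \<in> set ys \<Longrightarrow> h y \<in> ?S" "\<And>y. y \<in> set ys \<Longrightarrow> h y ?n = y"
    by metis
  have hzs: "h (zs ! l) ?n = zs ! l" if "set zs \<subseteq> set ys" "l < length zs" for zs l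
    using h(3) that nth_mem by blast
  have last_coordinate: "combination (map h zs) c ?n = (\<Sum>l<length zs. c l * zs ! l)"
    if "set zs \<subseteq> set ys" for zs c
    by (simp add: combination_def hzs[OF that])
  \<comment> \<open>Used with \<open>zs = ys\<close> to generate all syzygies, and with the initial segments of \<open>ys\<close> to
    compute the colon ideals of the new generators.\<close>
  have key: "v \<in> left_span (hs @ map h zs) \<longleftrightarrow> v ?n \<in> left_ideal zs"
    if v: "v \<in> ?S" and zs: "set zs \<subseteq> set ys" for v zs
  proof
    assume "v \<in> left_span (hs @ map h zs)"
    then obtain c where c: "\<forall>i. c i \<in> A"
      "(\<lambda>k. v k - combination (map h zs) c k) \<in> syzygies gs"
      unfolding left_span_append hs(3) by (elim exE conjE)
    from c(2) have "v ?n = (\<Sum>l<length zs. c l * zs ! l)"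
      by (simp add: syzygies_def free_module_def last_coordinate[OF zs])
    then show "v ?n \<in> left_ideal zs" unfolding left_ideal_def using c(1) by auto
  next
    assume "v ?n \<in> left_ideal zs"
    then obtain c where c: "\<forall>i. c i \<in> A" "v ?n = (\<Sum>l<length zs. c l * zs ! l)"
      unfolding left_ideal_def by auto
    let ?u = "\<lambda>k. v k - combination (map h zs) c k"
    have "?u \<in> ?S"
      using zs h(2) by (intro syzygies_linear_combination v c) auto
    moreover have "?u ?n = 0" using last_coordinate[OF zs] c(2) by simp
    ultimately have "?u \<in> left_span hs"
      unfolding hs(3) by (subst (asm) syzygies_snoc)
    then show "v \<in> left_span (hs @ map h zs)"
      unfolding left_span_append by (intro exI[of _ c] conjI c(1))
  qed
  let ?hs = "hs @ map h ys"
  have "left_span ?hs = ?S"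
  proof
    show "left_span ?hs \<subseteq> ?S"
    proof
      fix v assume "v \<in> left_span ?hs"
      then obtain c where c: "\<forall>i. c i \<in> A"
        "(\<lambda>k. v k - combination (map h ys) c k) \<in> syzygies gs" (is "?u \<in> _")
        unfolding left_span_append hs(3) by (elim exE conjE)
      have "?u ?n = 0" using c(2) by (simp add: syzygies_def free_module_def)
      then have "?u \<in> ?S" using syzygies_snoc[of ?u gs g] c(2) by simp
      then have "(\<lambda>k. ?u k + combination (map h ys) c k) \<in> ?S"
        using h(2) by (intro syzygies_linear_combination(2) c(1)) auto
      then show "v \<in> ?S" by simp
    qed
    show "?S \<subseteq> left_span ?hs"
    proof
      fix v assume v: "v \<in> ?S"
      then have vA: "v i \<in> A" if "i \<le> ?n" for i
        using that by (simp add: syzygies_def free_module_def)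
      have "combination gs v k + v ?n * g k = 0" for k
        using v by (simp add: syzygies_def combination_def nth_append fun_eq_iff)
      then have "(\<lambda>k. v ?n * g k) = (\<lambda>k. - combination gs v k)"
        by (metis add.commute eq_neg_iff_add_eq_0)
      also have "\<dots> = combination gs (\<lambda>i. if i < ?n then - v i else 0)"
        by (simp add: combination_def sum_negf)
      also have "\<dots> \<in> left_span gs"
        unfolding left_span_def using vA zero_mem_A subspace_neg[OF subspace_A] by auto
      finally have "v ?n \<in> left_ideal ys" using ys(2) vA by blast
      then show "v \<in> left_span ?hs" using key[OF v] by blast
    qed
  qed
  moreover have "set ?hs \<subseteq> free_module (G 1) (length (gs @ [g]))"
  proof -
    have "free_module (G 1) ?n \<subseteq> free_module (G 1) (Suc ?n)"
      using subspace_0[OF subspace_degree]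
      by (auto simp: free_module_def less_Suc_eq)
    then show ?thesis using hs(1) h(1) by auto
  qed
  moreover have "linear_quotients F ?hs"
    unfolding linear_quotients_def
  proof (intro allI impI)
    fix j assume j: "j < length ?hs"
    show "\<exists>zs\<in>F. {a \<in> A. (\<lambda>k. a * (?hs ! j) k) \<in> left_span (take j ?hs)} = left_ideal zs"
    proof (cases "j < length hs")
      case True
      then show ?thesis
        using hs(2)[unfolded linear_quotients_def] by (simp add: nth_append)
    next
      case False
      define l where "l = j - length hs"
      have l: "l < length ys" using j False by (simp add: l_def)
      have hl: "?hs ! j = h (ys ! l)" using False l by (simp add: nth_append l_def)
      have tl: "take j ?hs = hs @ map h (take l ys)"
        using False by (simp add: l_def take_map)
      have "(\<lambda>k. a * h (ys ! l) k) \<in> left_span (hs @ map h (take l ys)) \<longleftrightarrow>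
          a * ys ! l \<in> left_ideal (take l ys)" if a: "a \<in> A" for a
      proof -
        have "(\<lambda>k. 0 + combination [h (ys ! l)] (\<lambda>_. a) k) \<in> ?S"
          using h(2) l a zero_mem_A
          by (intro syzygies_linear_combination)
            (auto simp: syzygies_def free_module_def combination_def)
        then have "(\<lambda>k. a * h (ys ! l) k) \<in> ?S"
          by (simp add: combination_def)
        from key[OF this, of "take l ys"] show ?thesis
          using h(3) l by (simp add: set_take_subset)
      qed
      then show ?thesis unfolding hl tl using ysq[OF l] by auto
    qed
  qed
  ultimately show ?case by blast
qed

text \<open>The module of syzygies of a family with linear quotients is generated by another such family, so
  the construction can be repeated forever by dependent choice. It starts with the generators of the
  irrelevant ideal, seen as vectors of length one; the irrelevant ideal is the kernel of the
  augmentation.\<close>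

theorem koszul_filtration_imp_koszul:
  assumes F: "koszul_filtration F"
  shows "koszul_algebra scale A G"
proof unfold_locales
  obtain xs where xs: "xs \<in> F" "left_ideal xs = irrelevant_ideal"
    using F unfolding koszul_filtration_def by blast
  define e where "e x = (\<lambda>k::nat. if k = 0 then x else 0)" for x :: 'a
  have xsG: "set xs \<subseteq> G 1" using F xs(1) unfolding koszul_filtration_def by blast
  have comb_e: "combination (map e zs) b = e (\<Sum>i<length zs. b i * zs ! i)" for zs b
    by (auto simp: combination_def e_def fun_eq_iff)
  have e_inj: "e x = e y \<longleftrightarrow> x = y" for x y
    unfolding e_def fun_eq_iff by auto
  have span_e: "left_span (map e zs) = e ` left_ideal zs" for zs
    unfolding left_span_def left_ideal_def comb_e by blast
  define P where "P r gs \<longleftrightarrow> set gs \<subseteq> free_module (G 1) r \<and> linear_quotients F gs" for r gs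
  have start: "P 1 (map e xs)"
  proof -
    have "linear_quotients F (map e xs)"
      unfolding linear_quotients_def
    proof (intro allI impI)
      fix j assume j: "j < length (map e xs)"
      have "(\<lambda>k. a * e x k) = e (a * x)" for a x by (auto simp: e_def)
      then have "{a \<in> A. (\<lambda>k. a * (map e xs ! j) k) \<in> left_span (take j (map e xs))} =
          {a \<in> A. a * xs ! j \<in> left_ideal (take j xs)}"
        using j by (auto simp: take_map span_e image_iff e_inj)
      then show "\<exists>ys\<in>F. {a \<in> A. (\<lambda>k. a * (map e xs ! j) k) \<in> left_span (take j (map e xs))} =
          left_ideal ys"
        using F xs(1) j unfolding koszul_filtration_def by auto
    qed
    then show ?thesis using xsG by (auto simp: P_def e_def free_module_def)
  qed
  have step: "\<exists>hs. P (length gs) hs \<and> left_span hs = syzygies gs" if "P r gs" for r gs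
    using linear_quotients_syzygies[OF F] that unfolding P_def by blast
  have "\<exists>g. \<forall>i. (\<exists>r. P r (g i)) \<and> (i = 0 \<longrightarrow> g i = map e xs) \<and>
      (P (length (g i)) (g (Suc i)) \<and> left_span (g (Suc i)) = syzygies (g i))"
    using dependent_nat_choice[of "\<lambda>i gs. (\<exists>r. P r gs) \<and> (i = 0 \<longrightarrow> gs = map e xs)"
        "\<lambda>i gs hs. P (length gs) hs \<and> left_span hs = syzygies gs"] start step
    by (metis nat.distinct(1))
  then obtain g where g0: "g 0 = map e xs" and gS: "\<And>i. P (length (g i)) (g (Suc i))"
    "\<And>i. left_span (g (Suc i)) = syzygies (g i)" by auto
  define r where "r i = (case i of 0 \<Rightarrow> 1 | Suc i \<Rightarrow> length (g i))" for i
  have r: "r 0 = 1" "r (Suc i) = length (g i)" for i by (simp_all add: r_def)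
  have gr: "set (g i) \<subseteq> free_module (G 1) (r i)" for i
    using start gS(1) by (cases i) (auto simp: r g0 P_def)
  define d where "d i = combination (g i)" for i
  define \<eta> where "\<eta> v = augmentation (v (0::nat))" for v
  have image: "d i ` free_module A (r (Suc i)) = left_span (g i)" for i
    unfolding d_def r left_span_eq_image ..
  have "linear_resolution r d \<eta>"
    unfolding linear_resolution_def
  proof (intro conjI allI ballI impI)
    fix u v assume "u \<in> free_module A (r 0)" "v \<in> free_module A (r 0)"
    then show "\<eta> (\<lambda>k. u k + v k) = \<eta> u + \<eta> v"
      by (simp add: \<eta>_def r free_module_def augmentation_add)
  next
    fix a v assume "a \<in> A" "v \<in> free_module A (r 0)"
    then show "\<eta> (\<lambda>k. a * v k) = augmentation a * \<eta> v"
      by (simp add: \<eta>_def r free_module_def augmentation_mult)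
  next
    fix j :: nat and v assume "0 < j" and "v \<in> free_module_degree (r 0) 0 j"
    then have "v 0 \<in> G j" by (simp add: r free_module_degree_def free_module_def)
    moreover from this \<open>0 < j\<close> have "v 0 \<in> irrelevant_ideal"
      unfolding irrelevant_ideal_def by (blast intro: span_base)
    ultimately show "\<eta> v = 0"
      using augmentation_eq_0_iff degree_subset by (auto simp: \<eta>_def)
  next
    have "c \<in> \<eta> ` free_module A (r 0)" for c
    proof
      show "e (scale c 1) \<in> free_module A (r 0)"
        using one_mem degree_subset subspace_scale[OF subspace_A]
        by (auto simp: e_def r free_module_def)
      show "c = \<eta> (e (scale c 1))"
        using augmentation_eqI[of "scale c 1" c] subspace_0[OF subspace_irrelevant]
        by (simp add: \<eta>_def e_def)
    qed
    then show "\<eta> ` free_module A (r 0) = UNIV" by blast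
  next
    fix i u v
    show "d i (\<lambda>k. u k + v k) = (\<lambda>k. d i u k + d i v k)"
      by (simp add: d_def combination_def distrib_right sum.distrib)
  next
    fix i a v
    show "d i (\<lambda>k. a * v k) = (\<lambda>k. a * d i v k)"
      by (simp add: d_def combination_def sum_distrib_left mult.assoc)
  next
    fix i j
    show "d i ` free_module_degree (r (Suc i)) (Suc i) j \<subseteq> free_module_degree (r i) i j"
    proof
      fix w assume "w \<in> d i ` free_module_degree (r (Suc i)) (Suc i) j"
      then obtain v where v: "v \<in> free_module_degree (r (Suc i)) (Suc i) j" "w = d i v" by blast
      show "w \<in> free_module_degree (r i) i j"
      proof (cases "Suc i \<le> j")
        case True
        then have "w \<in> free_module (G (j - Suc i + 1)) (r i)"
          unfolding v(2) d_def using v(1)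
          by (intro combination_free_module gr) (simp add: free_module_degree_def free_module_def r)
        then show ?thesis using True by (simp add: free_module_degree_def Suc_diff_Suc Suc_le_eq)
      next
        case False
        then have "w = (\<lambda>_. 0)"
          using v by (simp add: free_module_degree_def d_def combination_def)
        then show ?thesis
          using subspace_0[OF subspace_degree] by (simp add: free_module_degree_def free_module_def)
      qed
    qed
  next
    have "e ` irrelevant_ideal = {v \<in> free_module A (r 0). \<eta> v = 0}"
    proof (intro equalityI subsetI)
      fix v assume "v \<in> e ` irrelevant_ideal"
      then show "v \<in> {v \<in> free_module A (r 0). \<eta> v = 0}"
        using irrelevant_subset augmentation_eq_0_iff
        by (auto simp: r free_module_def e_def \<eta>_def)
    next
      fix v assume v: "v \<in> {v \<in> free_module A (r 0). \<eta> v = 0}"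
      then have "v 0 \<in> irrelevant_ideal"
        using augmentation_eq_0_iff by (auto simp: r free_module_def \<eta>_def)
      moreover have "v = e (v 0)"
        using v by (auto simp: r free_module_def e_def fun_eq_iff)
      ultimately show "v \<in> e ` irrelevant_ideal" by blast
    qed
    then show "d 0 ` free_module A (r 1) = {v \<in> free_module A (r 0). \<eta> v = 0}"
      using image[of 0] by (simp add: g0 span_e xs(2))
  next
    fix i
    show "d (Suc i) ` free_module A (r (Suc (Suc i))) =
        {v \<in> free_module A (r (Suc i)). d i v = (\<lambda>_. 0)}"
      unfolding image gS(2) by (simp add: syzygies_def d_def r)
  qed
  then show "\<exists>r d \<eta>. linear_resolution r d \<eta>" by blast
qed

end


section \<open>Columns of tableaux\<close>

lemma Nil_notin_rows: "[] \<notin> set (rows T)"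
  using is_ssyt_rows[of T] unfolding is_ssyt_iff_row by blast

text \<open>The operation \<open>row\<close> pads a tableau by empty rows. In terms of it a product is computed row by row
  for all indices at once, without reference to the number of rows.\<close>

lemma mem_SSYT_iff:
  "T \<in> SSYT n m \<longleftrightarrow> (\<forall>i\<ge>n. row (rows T) i = []) \<and> (\<forall>i. set (row (rows T) i) \<subseteq> {1..m})"
proof -
  have "length (rows T) \<le> n \<longleftrightarrow> (\<forall>i\<ge>n. row (rows T) i = [])"
  proof
    assume *: "\<forall>i\<ge>n. row (rows T) i = []"
    show "length (rows T) \<le> n"
    proof (rule ccontr)
      assume "\<not> length (rows T) \<le> n"
      then have "row (rows T) n \<in> set (rows T)" by (simp add: row_def)
      then show False using * Nil_notin_rows by simp
    qed
  qed (simp add: row_def)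
  moreover have "(\<forall>r \<in> set (rows T). set r \<subseteq> {1..m}) \<longleftrightarrow> (\<forall>i. set (row (rows T) i) \<subseteq> {1..m})"
    unfolding all_set_conv_all_nth row_def by (auto split: if_splits)
  ultimately show ?thesis by (simp add: SSYT_def)
qed

lemma row_Nil [simp]: "row [] i = []"
  by (simp add: row_def)

lemma zero_mem_SSYT: "0 \<in> SSYT n m"
  by (simp add: mem_SSYT_iff)

lemma plus_mem_SSYT: "S \<in> SSYT n m \<Longrightarrow> T \<in> SSYT n m \<Longrightarrow> S + T \<in> SSYT n m"
  by (simp add: mem_SSYT_iff row_rows_plus)

lemma sorted_row: "sorted (row (rows T) i)"
  using is_ssyt_rows[of T] by (simp add: is_ssyt_iff_row)

lemma length_row_Suc: "length (row (rows T) (Suc i)) \<le> length (row (rows T) i)"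
  using is_ssyt_rows[of T] by (auto simp: is_ssyt_def row_def)

lemma length_row_antimono: "i \<le> j \<Longrightarrow> length (row (rows T) j) \<le> length (row (rows T) i)"
  using lift_Suc_antimono_le[of "\<lambda>i. length (row (rows T) i)" i j] length_row_Suc by blast

lemma columns_plus: "columns (S + T) = columns S + columns T"
  by (simp add: columns_def row_rows_plus)

lemma columns_eq_0_iff: "columns T = 0 \<longleftrightarrow> T = 0"
proof
  assume "columns T = 0"
  then have "row (rows T) i = []" for i
    using length_row_antimono[of 0 i T] by (simp add: columns_def)
  then show "T = 0" by (intro tableau_eqI) simp
qed (simp add: columns_def)

lemma plus_tableau_cancel: "S + U = T + U \<longleftrightarrow> S = T" for S T U :: tableau
proof
  assume eq: "S + U = T + U"
  show "S = T"
  proof (rule tableau_eqI)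
    fix i
    have "mset (row (rows (S + U)) i) = mset (row (rows (T + U)) i)" using eq by simp
    then have "mset (row (rows S) i) = mset (row (rows T) i)"
      by (simp add: row_rows_plus)
    then show "row (rows S) i = row (rows T) i"
      using properties_for_sort[of "row (rows S) i" "row (rows T) i"] sorted_row[of S i] sorted_row[of T i]
      by (simp add: sorted_sort_id)
  qed
qed simp

definition first_column :: "tableau \<Rightarrow> tableau" where
  "first_column T = Abs_tableau (map (\<lambda>r. [hd r]) (rows T))"

text \<open>The rows of length one become empty. Row lengths decrease weakly, so these are the last rows, and
  \<open>takeWhile\<close> removes exactly them.\<close>

definition other_columns :: "tableau \<Rightarrow> tableau" where
  "other_columns T = Abs_tableau (takeWhile (\<lambda>r. r \<noteq> []) (map tl (rows T)))"

lemma row_first_column: "row (rows (first_column T)) i = take 1 (row (rows T) i)"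
proof -
  let ?T = "rows T"
  have T: "is_ssyt ?T" by simp
  have ne: "r \<noteq> []" "0 \<notin> set r" if "r \<in> set ?T" for r
    using T that by (auto simp: is_ssyt_def)
  have "is_ssyt (map (\<lambda>r. [hd r]) ?T)"
    unfolding is_ssyt_def
  proof (intro conjI ballI allI impI)
    fix r assume "r \<in> set (map (\<lambda>r. [hd r]) ?T)"
    then show "r \<noteq> []" "sorted r" "0 \<notin> set r"
      using ne by auto (metis hd_in_set)
  next
    fix i assume i: "Suc i < length (map (\<lambda>r. [hd r]) ?T)"
    then show "length (map (\<lambda>r. [hd r]) ?T ! Suc i) \<le> length (map (\<lambda>r. [hd r]) ?T ! i)" by simp
    fix j assume "j < length (map (\<lambda>r. [hd r]) ?T ! Suc i)"
    moreover have "?T ! i ! 0 < ?T ! Suc i ! 0" "?T ! i \<noteq> []" "?T ! Suc i \<noteq> []"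
      using T i ne(1) by (auto simp: is_ssyt_def)
    ultimately show "map (\<lambda>r. [hd r]) ?T ! i ! j < map (\<lambda>r. [hd r]) ?T ! Suc i ! j"
      using i by (simp add: hd_conv_nth)
  qed
  then have "rows (first_column T) = map (\<lambda>r. [hd r]) ?T"
    by (simp add: first_column_def Abs_tableau_inverse)
  then show ?thesis
    using ne(1)[OF nth_mem] by (auto simp: row_def take_Suc)
qed

lemma set_tl_subset: "set (tl xs) \<subseteq> set xs"
  by (cases xs) auto

lemma row_other_columns: "row (rows (other_columns T)) i = tl (row (rows T) i)"
proof -
  let ?T = "rows T" and ?U = "takeWhile (\<lambda>r. r \<noteq> []) (map tl (rows T))"
  have T: "is_ssyt ?T" by simp
  have tl_eq_Nil: "tl q = [] \<longleftrightarrow> length q \<le> 1" for q :: "nat list"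
    by (cases q) auto
  have U: "?U ! i = tl (?T ! i)" "i < length ?T" "?U ! i \<noteq> []" if "i < length ?U" for i
  proof -
    have "length ?U \<le> length ?T" using length_takeWhile_le[of _ "map tl ?T"] by simp
    then show "i < length ?T" using that by simp
    then show "?U ! i = tl (?T ! i)" using that by (simp add: takeWhile_nth)
    show "?U ! i \<noteq> []" using nth_mem[OF that] set_takeWhileD by fastforce
  qed
  have "is_ssyt ?U"
    unfolding is_ssyt_def
  proof (intro conjI ballI allI impI)
    fix r assume "r \<in> set ?U"
    then obtain i where i: "i < length ?U" "r = ?U ! i" by (metis in_set_conv_nth)
    then have r: "r = tl (?T ! i)" "?T ! i \<in> set ?T" using U by simp_all
    show "r \<noteq> []" using i U(3) by simp
    have "sorted (?T ! i)" "0 \<notin> set (?T ! i)" using T r(2) unfolding is_ssyt_def by blast+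
    then show "sorted r" "0 \<notin> set r"
      unfolding r(1) using set_tl_subset[of "?T ! i"] by (auto simp: sorted_tl)
  next
    fix i assume i: "Suc i < length ?U"
    have i': "i < length ?U" using i by simp
    have *: "length (?T ! Suc i) \<le> length (?T ! i)"
      "\<forall>j < length (?T ! Suc i). ?T ! i ! j < ?T ! Suc i ! j"
      using T U(2)[OF i] by (simp_all add: is_ssyt_def)
    then show "length (?U ! Suc i) \<le> length (?U ! i)"
      using U(1)[OF i] U(1)[OF i'] by simp
    fix j assume "j < length (?U ! Suc i)"
    then show "?U ! i ! j < ?U ! Suc i ! j"
      using * U(1)[OF i] U(1)[OF i'] by (simp add: nth_tl)
  qed
  then have rows: "rows (other_columns T) = ?U"
    by (simp add: other_columns_def Abs_tableau_inverse)
  show ?thesis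
  proof (cases "i < length ?U")
    case True
    then show ?thesis using U[OF True] by (simp add: rows row_def)
  next
    case False
    let ?k = "length ?U"
    have "tl (row ?T ?k) = []"
    proof (cases "?k < length ?T")
      case True
      then show ?thesis
        using nth_length_takeWhile[of "\<lambda>r. r \<noteq> []" "map tl ?T"] by (simp add: row_def)
    qed (simp add: row_def)
    moreover have "length (row ?T i) \<le> length (row ?T ?k)"
      using length_row_antimono[of ?k i T] False by simp
    ultimately have "tl (row ?T i) = []"
      unfolding tl_eq_Nil by (rule le_trans[rotated])
    then show ?thesis using False by (simp add: rows row_def)
  qed
qed

lemma other_plus_first_columns: "other_columns T + first_column T = T"
proof (rule tableau_eqI)
  fix i
  have "sort (tl r @ take 1 r) = r" if "sorted r" for r :: "nat list"
    using that by (intro properties_for_sort) (cases r; simp)+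
  then show "row (rows (other_columns T + first_column T)) i = row (rows T) i"
    using sorted_row by (simp add: row_rows_plus row_first_column row_other_columns)
qed

lemma other_columns_mem_SSYT: "T \<in> SSYT n m \<Longrightarrow> other_columns T \<in> SSYT n m"
  unfolding mem_SSYT_iff row_other_columns
  using set_tl_subset by fastforce

definition single_columns :: "nat \<Rightarrow> nat \<Rightarrow> tableau set" where
  "single_columns n m = {c \<in> SSYT n m. columns c = 1}"

lemma first_column_mem_iff:
  assumes "T \<in> SSYT n m"
  shows "first_column T \<in> single_columns n m \<longleftrightarrow> T \<noteq> 0"
proof -
  have "first_column T \<in> SSYT n m"
    using assms unfolding mem_SSYT_iff row_first_column
    by (metis in_set_takeD subset_iff take_Nil)
  moreover have "columns (first_column T) = min 1 (columns T)"
    by (simp add: columns_def row_first_column min.commute)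
  ultimately show ?thesis
    using columns_eq_0_iff[of T] by (auto simp: single_columns_def min_def)
qed

lemma row_single_column:
  assumes "c \<in> single_columns n m"
  shows "length (row (rows c) i) \<le> 1"
  using assms length_row_antimono[of 0 i c] by (simp add: single_columns_def columns_def)

lemma finite_single_columns: "finite (single_columns n m)"
proof -
  have "set (rows c) \<subseteq> (\<lambda>x. [x]) ` {1..m} \<and> length (rows c) \<le> n"
    if c: "c \<in> single_columns n m" for c
  proof (intro conjI subsetI)
    fix r assume r: "r \<in> set (rows c)"
    then obtain i where i: "i < length (rows c)" "r = row (rows c) i"
      by (metis in_set_conv_nth row_def)
    have "r \<noteq> []" using Nil_notin_rows r by blast
    moreover have "length r \<le> 1" using row_single_column[OF c] i(2) by blast
    ultimately obtain x where x: "r = [x]" by (cases r) simp_all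
    have "set r \<subseteq> {1..m}" using c i(2) by (simp add: single_columns_def mem_SSYT_iff)
    then show "r \<in> (\<lambda>x. [x]) ` {1..m}" using x by simp
  next
    show "length (rows c) \<le> n" using c by (simp add: single_columns_def SSYT_def)
  qed
  then have "rows ` single_columns n m \<subseteq> {xs. set xs \<subseteq> (\<lambda>x. [x]) ` {1..m} \<and> length xs \<le> n}"
    by blast
  then have "finite (rows ` single_columns n m)"
    by (rule finite_subset) (intro finite_lists_length_le finite_imageI finite_atLeastAtMost)
  then show ?thesis
    by (rule finite_imageD) (simp add: inj_on_def rows_inject)
qed


section \<open>The order on columns\<close>

text \<open>The first entry of a row is its least entry, and the infimum of the empty set is \<open>\<infinity>\<close>. Pointwise
  comparison of these functions is the lattice order on columns. The empty tableau becomes the top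
  element.\<close>

definition first_entry :: "tableau \<Rightarrow> nat \<Rightarrow> enat" where
  "first_entry T i = (INF x\<in>set (row (rows T) i). enat x)"

lemma first_entry_plus: "first_entry (S + T) = inf (first_entry S) (first_entry T)"
  by (simp add: fun_eq_iff first_entry_def row_rows_plus INF_union)

lemma first_entry_zero: "first_entry 0 = top"
  by (simp add: fun_eq_iff first_entry_def)

lemma first_entry_first_column: "first_entry (first_column T) = first_entry T"
proof
  fix i
  have "(INF x\<in>set (take 1 r). enat x) = (INF x\<in>set r. enat x)" if "sorted r" for r
    using that by (cases r) (auto intro!: antisym INF_greatest INF_lower2)
  then show "first_entry (first_column T) i = first_entry T i"
    using sorted_row by (simp add: first_entry_def row_first_column)
qed

lemma first_entry_inj:
  assumes "c \<in> single_columns n m" "d \<in> single_columns n m" "first_entry c = first_entry d"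
  shows "c = d"
proof (rule tableau_eqI)
  fix i
  have eq: "(INF x\<in>set (row (rows c) i). enat x) = (INF x\<in>set (row (rows d) i). enat x)"
    using fun_cong[OF assms(3), of i] by (simp add: first_entry_def)
  show "row (rows c) i = row (rows d) i"
    using row_single_column[OF assms(1), of i] row_single_column[OF assms(2), of i] eq
    by (cases "row (rows c) i"; cases "row (rows d) i") (auto simp: top_enat_def inf_min)
qed

text \<open>These lists enumerate down-sets of columns along a linear extension of the order: every initial
  segment has to be a down-set as well.\<close>

definition initial_lists :: "nat \<Rightarrow> nat \<Rightarrow> tableau list set" where
  "initial_lists n m = {cs. distinct cs \<and> set cs \<subseteq> single_columns n m \<and>
     (\<forall>j\<le>length cs. \<forall>d \<in> set (take j cs). \<forall>c \<in> single_columns n m.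
        first_entry c \<le> first_entry d \<longrightarrow> c \<in> set (take j cs))}"

text \<open>A maximal element of the down-set can be listed last, since the others still form a down-set.\<close>

lemma ex_initial_list:
  assumes "D \<subseteq> single_columns n m"
    and "\<And>c d. d \<in> D \<Longrightarrow> c \<in> single_columns n m \<Longrightarrow> first_entry c \<le> first_entry d \<Longrightarrow> c \<in> D"
  shows "\<exists>cs \<in> initial_lists n m. set cs = D"
proof -
  have "finite D" using assms(1) finite_single_columns finite_subset by blast
  then show ?thesis
    using assms
  proof (induction D rule: finite_psubset_induct)
    case (psubset D)
    show ?case
    proof (cases "D = {}")
      case True
      then show ?thesis by (intro bexI[of _ "[]"]) (simp_all add: initial_lists_def)
    next
      case False
      obtain d where d: "d \<in> D"
        "\<And>c. c \<in> D \<Longrightarrow> first_entry d \<le> first_entry c \<Longrightarrow> first_entry d = first_entry c"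
        using finite_has_maximal[of "first_entry ` D"] psubset.hyps False by auto
      have "\<exists>cs \<in> initial_lists n m. set cs = D - {d}"
      proof (rule psubset.IH)
        show "D - {d} \<subset> D" "D - {d} \<subseteq> single_columns n m" using d(1) psubset.prems(1) by auto
        fix b c
        assume bc: "b \<in> D - {d}" "c \<in> single_columns n m" "first_entry c \<le> first_entry b"
        then have "c \<noteq> d"
          using d(2)[of b] first_entry_inj[of d n m b] psubset.prems(1) by auto
        then show "c \<in> D - {d}" using bc psubset.prems(2) by blast
      qed
      then obtain cs where cs: "cs \<in> initial_lists n m" "set cs = D - {d}" by blast
      have "cs @ [d] \<in> initial_lists n m"
        unfolding initial_lists_def mem_Collect_eq
      proof (intro conjI allI impI)
        show "distinct (cs @ [d])" "set (cs @ [d]) \<subseteq> single_columns n m"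
          using cs d(1) psubset.prems(1) by (auto simp: initial_lists_def)
        fix j assume "j \<le> length (cs @ [d])"
        then consider "j \<le> length cs" | "j = length (cs @ [d])" by fastforce
        then show "\<forall>d' \<in> set (take j (cs @ [d])). \<forall>c \<in> single_columns n m.
            first_entry c \<le> first_entry d' \<longrightarrow> c \<in> set (take j (cs @ [d]))"
        proof cases
          case 1
          then show ?thesis using cs(1) by (simp add: initial_lists_def)
        next
          case 2
          then have "set (take j (cs @ [d])) = D" using cs(2) d(1) by auto
          then show ?thesis using psubset.prems(2) by blast
        qed
      qed
      moreover have "set (cs @ [d]) = D" using cs(2) d(1) by auto
      ultimately show ?thesis by blast
    qed
  qed
qed


section \<open>The tableaux algebra\<close>

lemma lookup_tableaux_scale:
  "Poly_Mapping.lookup (tableaux_scale c f) T = c * Poly_Mapping.lookup f T"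
  by (simp add: tableaux_scale_def map.rep_eq when_def)

lemma tableaux_scale_eq_mult: "tableaux_scale c f = Poly_Mapping.single 0 c * f"
  by (simp add: tableaux_scale_def mult_map_scale_conv_mult)

lemma sum_single_lookup:
  "(\<Sum>x\<in>Poly_Mapping.keys f. Poly_Mapping.single x (Poly_Mapping.lookup f x)) = f"
  by (rule poly_mapping_eqI)
    (simp add: lookup_sum lookup_single when_def sum.delta' in_keys_iff)

lemma keys_subset_iff: "Poly_Mapping.keys f \<subseteq> X \<longleftrightarrow> (\<forall>T. T \<notin> X \<longrightarrow> Poly_Mapping.lookup f T = 0)"
  by (auto simp: in_keys_iff)

lemma vector_space_tableaux_scale:
  "vector_space (tableaux_scale :: 'k::field \<Rightarrow> (tableau \<Rightarrow>\<^sub>0 'k) \<Rightarrow> (tableau \<Rightarrow>\<^sub>0 'k))"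
  by unfold_locales
    (auto intro!: poly_mapping_eqI simp: lookup_tableaux_scale lookup_add algebra_simps)

lemma subspace_keys_subset:
  "module.subspace tableaux_scale {f :: tableau \<Rightarrow>\<^sub>0 'k::field. Poly_Mapping.keys f \<subseteq> X}"
proof -
  interpret vector_space "tableaux_scale :: 'k \<Rightarrow> (tableau \<Rightarrow>\<^sub>0 'k) \<Rightarrow> (tableau \<Rightarrow>\<^sub>0 'k)"
    by (rule vector_space_tableaux_scale)
  show ?thesis
    unfolding keys_subset_iff by (rule subspaceI) (simp_all add: lookup_add lookup_tableaux_scale)
qed

interpretation tableaux: connected_graded_algebra
  "tableaux_scale :: 'k::field \<Rightarrow> (tableau \<Rightarrow>\<^sub>0 'k) \<Rightarrow> (tableau \<Rightarrow>\<^sub>0 'k)"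
  "tableaux_algebra n m" "tableaux_degree n m" for n m
proof -
  interpret vector_space "tableaux_scale :: 'k \<Rightarrow> (tableau \<Rightarrow>\<^sub>0 'k) \<Rightarrow> (tableau \<Rightarrow>\<^sub>0 'k)"
    by (rule vector_space_tableaux_scale)
  show "connected_graded_algebra (tableaux_scale :: 'k \<Rightarrow> (tableau \<Rightarrow>\<^sub>0 'k) \<Rightarrow> (tableau \<Rightarrow>\<^sub>0 'k))
      (tableaux_algebra n m) (tableaux_degree n m)"
  proof
    fix c and x y :: "tableau \<Rightarrow>\<^sub>0 'k"
    show "tableaux_scale c (x * y) = tableaux_scale c x * y"
      "tableaux_scale c (x * y) = x * tableaux_scale c y"
      by (simp_all add: tableaux_scale_eq_mult mult.assoc mult.left_commute)
  next
    fix i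
    show "subspace (tableaux_degree n m i :: (tableau \<Rightarrow>\<^sub>0 'k) set)"
      unfolding tableaux_degree_def by (rule subspace_keys_subset)
  next
    let ?S = "span (\<Union>i. tableaux_degree n m i) :: (tableau \<Rightarrow>\<^sub>0 'k) set"
    show "tableaux_algebra n m = ?S"
    proof
      show "tableaux_algebra n m \<subseteq> ?S"
      proof
        fix f :: "tableau \<Rightarrow>\<^sub>0 'k" assume "f \<in> tableaux_algebra n m"
        then have "Poly_Mapping.single T (Poly_Mapping.lookup f T) \<in> tableaux_degree n m (columns T)"
          if "T \<in> Poly_Mapping.keys f" for T
          using that by (auto simp: tableaux_algebra_def tableaux_degree_def)
        then have "(\<Sum>T\<in>Poly_Mapping.keys f. Poly_Mapping.single T (Poly_Mapping.lookup f T)) \<in> ?S"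
          by (intro span_sum span_base) blast
        then show "f \<in> ?S" by (simp add: sum_single_lookup)
      qed
      show "?S \<subseteq> tableaux_algebra n m"
        unfolding tableaux_algebra_def
        by (intro span_minimal subspace_keys_subset) (auto simp: tableaux_degree_def)
    qed
  next
    fix N i and g :: "nat \<Rightarrow> tableau \<Rightarrow>\<^sub>0 'k"
    assume g: "\<And>i. i \<le> N \<Longrightarrow> g i \<in> tableaux_degree n m i" "(\<Sum>i\<le>N. g i) = 0" "i \<le> N"
    show "g i = 0"
    proof (rule poly_mapping_eqI, rule ccontr)
      fix T assume T: "Poly_Mapping.lookup (g i) T \<noteq> Poly_Mapping.lookup 0 T"
      have keys: "T \<in> Poly_Mapping.keys (g j) \<Longrightarrow> columns T = j" if "j \<le> N" for j
        using g(1)[OF that] by (auto simp: tableaux_degree_def)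
      have "columns T = i" using keys[OF g(3)] T by (simp add: in_keys_iff)
      then have "Poly_Mapping.lookup (g j) T = (if j = i then Poly_Mapping.lookup (g i) T else 0)"
        if "j \<le> N" for j
        using keys[OF that] by (simp add: in_keys_iff) blast
      then have "(\<Sum>j\<le>N. Poly_Mapping.lookup (g j) T) =
          (\<Sum>j\<le>N. if j = i then Poly_Mapping.lookup (g i) T else 0)"
        by (intro sum.cong) auto
      then have "Poly_Mapping.lookup (\<Sum>i\<le>N. g i) T = Poly_Mapping.lookup (g i) T"
        using g(3) by (simp add: lookup_sum sum.delta)
      then show False using T g(2) by simp
    qed
  next
    fix i j and a b :: "tableau \<Rightarrow>\<^sub>0 'k"
    assume "a \<in> tableaux_degree n m i" "b \<in> tableaux_degree n m j"
    then have "{S + T |S T. S \<in> Poly_Mapping.keys a \<and> T \<in> Poly_Mapping.keys b} \<subseteq>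
        {T \<in> SSYT n m. columns T = i + j}"
      by (auto simp: tableaux_degree_def subset_iff columns_plus plus_mem_SSYT)
    then show "a * b \<in> tableaux_degree n m (i + j)"
      unfolding tableaux_degree_def using keys_mult[of a b] by blast
  next
    have zero: "{T \<in> SSYT n m. columns T = 0} = {0}"
      using zero_mem_SSYT by (auto simp: columns_eq_0_iff)
    show "(tableaux_degree n m 0 :: (tableau \<Rightarrow>\<^sub>0 'k) set) = range (\<lambda>c. tableaux_scale c 1)"
      unfolding tableaux_degree_def zero keys_subset_iff
    proof
      show "{f :: tableau \<Rightarrow>\<^sub>0 'k. \<forall>T. T \<notin> {0} \<longrightarrow> Poly_Mapping.lookup f T = 0} \<subseteq>
          range (\<lambda>c. tableaux_scale c 1)"
      proof
        fix f :: "tableau \<Rightarrow>\<^sub>0 'k"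
        assume "f \<in> {f. \<forall>T. T \<notin> {0} \<longrightarrow> Poly_Mapping.lookup f T = 0}"
        then have "f = tableaux_scale (Poly_Mapping.lookup f 0) 1"
          by (intro poly_mapping_eqI) (simp add: lookup_tableaux_scale lookup_one when_def)
        then show "f \<in> range (\<lambda>c. tableaux_scale c 1)" by blast
      qed
      show "range (\<lambda>c. tableaux_scale c 1) \<subseteq>
          {f :: tableau \<Rightarrow>\<^sub>0 'k. \<forall>T. T \<notin> {0} \<longrightarrow> Poly_Mapping.lookup f T = 0}"
        by (auto simp: lookup_tableaux_scale lookup_one when_def)
    qed
  qed
qed

abbreviation monomial :: "tableau \<Rightarrow> (tableau \<Rightarrow>\<^sub>0 'k::field)" where
  "monomial T \<equiv> Poly_Mapping.single T 1"

text \<open>The monoid of tableaux is cancellative, so multiplication by a monomial merges no terms.\<close>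

lemma keys_mult_monomial:
  "Poly_Mapping.keys (f * monomial c :: tableau \<Rightarrow>\<^sub>0 'k::field) = (\<lambda>T. T + c) ` Poly_Mapping.keys f"
proof -
  have "f * monomial c =
      (\<Sum>T\<in>Poly_Mapping.keys f. Poly_Mapping.single T (Poly_Mapping.lookup f T)) * monomial c"
    by (simp add: sum_single_lookup)
  also have "\<dots> = (\<Sum>T\<in>Poly_Mapping.keys f. Poly_Mapping.single (T + c) (Poly_Mapping.lookup f T))"
    by (simp add: sum_distrib_right mult_single)
  finally have eq: "f * monomial c = \<dots>" .
  have "Poly_Mapping.lookup (f * monomial c) (T + c) = Poly_Mapping.lookup f T" for T
  proof -
    have "Poly_Mapping.lookup (f * monomial c) (T + c) =
        (\<Sum>S\<in>Poly_Mapping.keys f. if S = T then Poly_Mapping.lookup f S else 0)"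
      unfolding eq by (simp add: lookup_sum lookup_single when_def plus_tableau_cancel)
    then show ?thesis by (simp add: sum.delta in_keys_iff)
  qed
  moreover have "Poly_Mapping.keys (f * monomial c) \<subseteq> (\<lambda>T. T + c) ` Poly_Mapping.keys f"
    using keys_mult[of f "monomial c"] by auto
  ultimately show ?thesis by (force simp: in_keys_iff)
qed

text \<open>The first column of a multiple of \<open>c\<close> lies below \<open>c\<close>, hence in the down-set. Conversely a tableau
  is a multiple of its first column.\<close>

lemma left_ideal_initial_list:
  assumes cs: "cs \<in> initial_lists n m"
  shows "tableaux.left_ideal n m (map monomial cs :: (tableau \<Rightarrow>\<^sub>0 'k::field) list) =
    {f \<in> tableaux_algebra n m. \<forall>T\<in>Poly_Mapping.keys f. first_column T \<in> set cs}"
    (is "?I = ?R")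
proof
  show "?I \<subseteq> ?R"
  proof
    fix f :: "tableau \<Rightarrow>\<^sub>0 'k" assume "f \<in> ?I"
    then obtain b where b: "\<And>i. b i \<in> tableaux_algebra n m"
      "f = (\<Sum>i<length cs. b i * monomial (cs ! i))"
      by (auto simp: tableaux.left_ideal_def)
    have "T \<in> SSYT n m \<and> first_column T \<in> set cs" if T: "T \<in> Poly_Mapping.keys f" for T
    proof -
      obtain i where i: "i < length cs" "T \<in> Poly_Mapping.keys (b i * monomial (cs ! i))"
        using T keys_sum[of "\<lambda>i. b i * monomial (cs ! i)" "{..<length cs}"] unfolding b(2) by blast
      then obtain S where S: "S \<in> SSYT n m" "T = S + cs ! i"
        using b(1)[of i] by (auto simp: keys_mult_monomial tableaux_algebra_def)
      have c: "cs ! i \<in> set cs" "cs ! i \<in> single_columns n m"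
        using cs i(1) by (auto simp: initial_lists_def)
      then have TS: "T \<in> SSYT n m"
        using S by (simp add: plus_mem_SSYT single_columns_def)
      have "columns T \<noteq> 0" using c(2) S(2) by (simp add: columns_plus single_columns_def)
      then have "T \<noteq> 0" by (simp add: columns_eq_0_iff)
      then have "first_column T \<in> single_columns n m" using first_column_mem_iff[OF TS] by simp
      moreover have "first_entry (first_column T) \<le> first_entry (cs ! i)"
        by (simp add: first_entry_first_column S(2) first_entry_plus)
      moreover have "\<forall>d \<in> set cs. \<forall>c \<in> single_columns n m.
          first_entry c \<le> first_entry d \<longrightarrow> c \<in> set cs"
        using cs unfolding initial_lists_def by (auto dest: spec[of _ "length cs"])
      ultimately show ?thesis using TS c(1) by blast
    qed
    then show "f \<in> ?R" by (auto simp: tableaux_algebra_def)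
  qed
  show "?R \<subseteq> ?I"
  proof
    fix f :: "tableau \<Rightarrow>\<^sub>0 'k" assume f: "f \<in> ?R"
    let ?K = "\<lambda>i. {T \<in> Poly_Mapping.keys f. first_column T = cs ! i}"
    \<comment> \<open>Divide each term of \<open>f\<close> by its first column and collect the quotients.\<close>
    define b where "b i = (\<Sum>T\<in>?K i.
        Poly_Mapping.single (other_columns T) (Poly_Mapping.lookup f T))" for i
    have "f = (\<Sum>T\<in>Poly_Mapping.keys f. Poly_Mapping.single T (Poly_Mapping.lookup f T))"
      by (simp add: sum_single_lookup)
    also have "Poly_Mapping.keys f = (\<Union>i<length cs. ?K i)"
      using f by (auto simp: set_conv_nth)
    also have "(\<Sum>T\<in>(\<Union>i<length cs. ?K i). Poly_Mapping.single T (Poly_Mapping.lookup f T)) =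
        (\<Sum>i<length cs. \<Sum>T\<in>?K i. Poly_Mapping.single T (Poly_Mapping.lookup f T))"
      using cs by (intro sum.UNION_disjoint) (auto simp: initial_lists_def nth_eq_iff_index_eq)
    also have "\<dots> = (\<Sum>i<length cs. b i * monomial (cs ! i))"
    proof (rule sum.cong[OF refl])
      fix i
      have "Poly_Mapping.single (other_columns T) (Poly_Mapping.lookup f T) * monomial (cs ! i) =
          Poly_Mapping.single T (Poly_Mapping.lookup f T)" if "T \<in> ?K i" for T
        using that other_plus_first_columns[of T] by (simp add: mult_single)
      then show "(\<Sum>T\<in>?K i. Poly_Mapping.single T (Poly_Mapping.lookup f T)) =
          b i * monomial (cs ! i)"
        by (simp add: b_def sum_distrib_right)
    qed
    finally have "f = (\<Sum>i<length cs. b i * monomial (cs ! i))" .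
    moreover have "b i \<in> tableaux_algebra n m" for i
      unfolding b_def using f
      by (intro tableaux.subspace_sum[OF tableaux.subspace_A])
        (auto simp: tableaux_algebra_def other_columns_mem_SSYT)
    ultimately show "f \<in> ?I" by (auto simp: tableaux.left_ideal_def)
  qed
qed

lemma take_initial_list: "cs \<in> initial_lists n m \<Longrightarrow> take j cs \<in> initial_lists n m"
  by (auto simp: initial_lists_def min_def dest: in_set_takeD)

text \<open>The first column of the product is the meet of \<open>d = cs ! j\<close> and the first column of \<open>T\<close>. It is \<open>d\<close>
  itself or lies strictly below \<open>d\<close>, and all columns strictly below \<open>d\<close> are listed before \<open>d\<close>.\<close>

lemma first_column_plus_mem_iff:
  assumes cs: "cs \<in> initial_lists n m" and j: "j < length cs" and T: "T \<in> SSYT n m"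
  shows "first_column (T + cs ! j) \<in> set (take j cs) \<longleftrightarrow> \<not> first_entry (cs ! j) \<le> first_entry T"
proof -
  let ?d = "cs ! j" and ?c = "first_column (T + cs ! j)"
  have d: "?d \<in> single_columns n m" "?d \<notin> set (take j cs)"
    using cs j by (auto simp: initial_lists_def in_set_conv_nth[of _ "take j cs"] nth_eq_iff_index_eq)
  have "columns (T + ?d) \<noteq> 0" using d(1) by (simp add: columns_plus single_columns_def)
  then have c: "?c \<in> single_columns n m"
    using first_column_mem_iff[of "T + ?d" n m] T d(1)
    by (simp add: columns_eq_0_iff plus_mem_SSYT single_columns_def)
  have ec: "first_entry ?c = inf (first_entry T) (first_entry ?d)"
    by (simp add: first_entry_first_column first_entry_plus)
  show ?thesis
  proof
    assume *: "?c \<in> set (take j cs)"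
    show "\<not> first_entry ?d \<le> first_entry T"
    proof
      assume "first_entry ?d \<le> first_entry T"
      then have "first_entry ?c = first_entry ?d" using ec by (simp add: inf.absorb2)
      then show False using first_entry_inj[OF c d(1)] * d(2) by simp
    qed
  next
    assume *: "\<not> first_entry ?d \<le> first_entry T"
    have "?d \<in> set (take (Suc j) cs)" using j by (simp add: take_Suc_conv_app_nth)
    then have "?c \<in> set (take (Suc j) cs)"
      using cs j c ec unfolding initial_lists_def by auto
    moreover have "?c \<noteq> ?d"
      using * ec by (metis inf.cobounded1)
    ultimately show "?c \<in> set (take j cs)" using j by (simp add: take_Suc_conv_app_nth)
  qed
qed

lemma irrelevant_ideal_tableaux:
  "tableaux.irrelevant_ideal n m =
    {f :: tableau \<Rightarrow>\<^sub>0 'k::field. Poly_Mapping.keys f \<subseteq> SSYT n m - {0}}"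
    (is "_ = ?R")
proof
  show "tableaux.irrelevant_ideal n m \<subseteq> ?R"
    unfolding tableaux.irrelevant_ideal_def
  proof (rule tableaux.span_minimal)
    show "tableaux.subspace ?R" by (rule subspace_keys_subset)
    show "(\<Union>i\<in>{0<..}. tableaux_degree n m i) \<subseteq> ?R"
      using columns_eq_0_iff[of 0] by (auto simp: tableaux_degree_def subset_iff)
  qed
  show "?R \<subseteq> tableaux.irrelevant_ideal n m"
  proof
    fix f :: "tableau \<Rightarrow>\<^sub>0 'k" assume f: "f \<in> ?R"
    have "Poly_Mapping.single T (Poly_Mapping.lookup f T) \<in> tableaux.irrelevant_ideal n m"
      if T: "T \<in> Poly_Mapping.keys f" for T
    proof -
      have "T \<in> SSYT n m" "columns T \<in> {0<..}" using f T columns_eq_0_iff[of T] by auto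
      moreover from this have "Poly_Mapping.single T (Poly_Mapping.lookup f T) \<in>
          tableaux_degree n m (columns T)"
        by (simp add: tableaux_degree_def)
      ultimately show ?thesis
        unfolding tableaux.irrelevant_ideal_def by (intro tableaux.span_base) blast
    qed
    then have "(\<Sum>T\<in>Poly_Mapping.keys f. Poly_Mapping.single T (Poly_Mapping.lookup f T)) \<in>
        tableaux.irrelevant_ideal n m"
      by (intro tableaux.subspace_sum[OF tableaux.subspace_irrelevant])
    then show "f \<in> tableaux.irrelevant_ideal n m" by (simp add: sum_single_lookup)
  qed
qed

text \<open>By \<open>first_column_plus_mem_iff\<close>, a tableau belongs to the colon ideal of \<open>d = cs ! j\<close> if and only if
  its first column does not lie above \<open>d\<close>, and the columns that do not lie above \<open>d\<close> form a down-set.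
  The empty tableau, being the top element, lies above \<open>d\<close>, so that it is excluded on both sides.\<close>

lemma koszul_filtration_initial_lists:
  "tableaux.koszul_filtration n m
    ((\<lambda>cs. map monomial cs :: (tableau \<Rightarrow>\<^sub>0 'k::field) list) ` initial_lists n m)"
  unfolding tableaux.koszul_filtration_def ball_simps bex_simps
proof (intro conjI ballI allI impI)
  fix cs assume cs: "cs \<in> initial_lists n m"
  then show "set (map monomial cs :: (tableau \<Rightarrow>\<^sub>0 'k) list) \<subseteq> tableaux_degree n m 1"
    by (auto simp: initial_lists_def single_columns_def tableaux_degree_def)
  fix j assume "j < length (map monomial cs :: (tableau \<Rightarrow>\<^sub>0 'k) list)"
  then have j: "j < length cs" by simp
  let ?D = "{c \<in> single_columns n m. \<not> first_entry (cs ! j) \<le> first_entry c}"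
  obtain ds where ds: "ds \<in> initial_lists n m" "set ds = ?D"
    using ex_initial_list[of ?D n m] by (auto dest: order.trans)
  have D: "first_column T \<in> ?D \<longleftrightarrow> \<not> first_entry (cs ! j) \<le> first_entry T" if "T \<in> SSYT n m" for T
    using first_column_mem_iff[OF that] first_entry_zero
    by (auto simp: first_entry_first_column)
  show "\<exists>ds\<in>initial_lists n m. {f \<in> tableaux_algebra n m. f * map monomial cs ! j \<in>
      tableaux.left_ideal n m (take j (map monomial cs))} =
      (tableaux.left_ideal n m (map monomial ds) :: (tableau \<Rightarrow>\<^sub>0 'k) set)"
  proof (intro bexI[of _ ds] set_eqI)
    fix f :: "tableau \<Rightarrow>\<^sub>0 'k"
    have "f * monomial (cs ! j) \<in> tableaux.left_ideal n m (map monomial (take j cs)) \<longleftrightarrow>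
        (\<forall>T\<in>Poly_Mapping.keys f. first_column T \<in> ?D)" if f: "f \<in> tableaux_algebra n m"
    proof -
      have "monomial (cs ! j) \<in> (tableaux_algebra n m :: (tableau \<Rightarrow>\<^sub>0 'k) set)"
        using cs nth_mem[OF j]
        by (auto simp: initial_lists_def single_columns_def tableaux_algebra_def)
      then have "f * monomial (cs ! j) \<in> tableaux_algebra n m"
        using f by (rule tableaux.mult_mem_A[rotated])
      then show ?thesis
        using f first_column_plus_mem_iff[OF cs j] D
        unfolding left_ideal_initial_list[OF take_initial_list[OF cs]]
        by (simp add: keys_mult_monomial tableaux_algebra_def subset_iff)
    qed
    then show "f \<in> {f \<in> tableaux_algebra n m. f * map monomial cs ! j \<in>
      tableaux.left_ideal n m (take j (map monomial cs))} \<longleftrightarrow>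
      f \<in> tableaux.left_ideal n m (map monomial ds)"
      unfolding left_ideal_initial_list[OF ds(1)] ds(2) using j by (auto simp: take_map)
  qed (rule ds(1))
next
  obtain cs where cs: "cs \<in> initial_lists n m" "set cs = single_columns n m"
    using ex_initial_list[of "single_columns n m" n m] by blast
  have "tableaux.left_ideal n m (map monomial cs :: (tableau \<Rightarrow>\<^sub>0 'k) list) =
      tableaux.irrelevant_ideal n m"
    unfolding left_ideal_initial_list[OF cs(1)] cs(2) irrelevant_ideal_tableaux
    using first_column_mem_iff[of _ n m] first_column_mem_iff[OF zero_mem_SSYT, of n m]
    by (auto simp: tableaux_algebra_def)
  then show "\<exists>cs\<in>initial_lists n m.
      tableaux.left_ideal n m (map monomial cs :: (tableau \<Rightarrow>\<^sub>0 'k) list) =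
      tableaux.irrelevant_ideal n m"
    using cs(1) by blast
qed

theorem corollary2p14:
  fixes m n :: nat
  assumes "1 \<le> n" and "n \<le> m"
  shows "koszul_algebra tableaux_scale
    (tableaux_algebra n m :: (tableau \<Rightarrow>\<^sub>0 'k::{alg_closed_field, field_char_0}) set)
    (tableaux_degree n m)"
  using koszul_filtration_initial_lists by (rule tableaux.koszul_filtration_imp_koszul)

end
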